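(* Let $n\ge1$, let $M$ be one of $\imath\mathrm{o}(2n)$ ($\nu=-1/2$), $\imath\mathrm{o}(2n+1)$ ($\nu=+1/2$), $\imath\mathrm{usp}(2n)$ ($\nu=+1/2$), $M_\nu$ ($\nu\in\mathbb N_0$), and let $\omega\in L^1_\nu(\mathbb R_+)$ be the weight of a P\'olya ensemble on $M$, so that the joint probability density of the squared singular values is $$p_A(x)=\frac{1}{n!}\left(\prod_{j=0}^{n-1}\frac{\Gamma[\nu+1]}{\mathcal H_\nu\omega(0)\,j!\,\Gamma[\nu+j+1]}\right)\Delta_n(x)\det\left[(\partial_{x_a}x_a^{\nu+1}\partial_{x_a}x_a^{-\nu})^{b-1}\omega(x_a)\right]_{a,b=1,\ldots,n},\qquad x\in\mathbb R_+^n.$$ Then this density can be described by the bi-orthonormal functions $\{p_j,q_j\}_{j=0,\ldots,n-1}$ on $\mathbb R_+$ given by $$p_j(y')=\int_0^\infty dr\,e^{-r}\left.\frac{\Gamma(\nu+1)\,(r-\partial_t\,{y'}^{-\nu}\partial_{y'}{y'}^{\nu+1}\partial_{y'})^{n-1}}{(n-1)!\,j!\,\Gamma(\nu+j+1)}\frac{{y'}^j}{\mathcal H_\nu\omega(t)}\right|_{t=0},\qquad q_j(y)=(\partial_yy^{\nu+1}\partial_yy^{-\nu})^j\omega(y),$$ and its kernel is $$K_n(y',y)=\frac{(-1)^{n-1}\Gamma(\nu+1)}{((n-1)!)^2\,\Gamma(\nu+n)}\int_0^\infty\!\!\int_0^\infty dr\,dR\,R^{n-1}e^{-r-R}\left.(r-\partial_t\,{y'}^{-\nu}\partial_{y'}{y'}^{\nu+1}\partial_{y'})^{n-1}\frac{1}{\mathcal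 H_\nu\omega(t)}\right|_{t=0}L_{n-1}^{(\nu)}\!\left(-\frac{y'}{R}\,\partial_yy^{\nu+1}\partial_yy^{-\nu}\right)\omega(y),$$ where $L^{(\nu)}_{k}(x)=x^k+\ldots$ are the generalized Laguerre polynomials in monic normalization and the differential operator in $y'$ acts on everything to its right.
   Context: Matrix spaces: $\imath\mathrm o(m)$ is the space of Hermitian antisymmetric $m\times m$ matrices, with group $\mathcal K=\mathrm O(m)$; $\imath\mathrm{usp}(2n)$ is the space of Hermitian anti-self-dual $2n\times2n$ matrices ($\imath$ times the Lie algebra of $\mathcal K=\mathrm{USp}(2n)$); $M_\nu$ is the space of matrices $\begin{bmatrix}0 & W \\ W^* & 0\end{bmatrix}$ with $W\in\mathbb C^{n\times(n+\nu)}$, with $\mathcal K=\mathrm U(n)\times\mathrm U(n+\nu)$. $\mathcal K$ acts by $m\mapsto kmk^*$. The non-trivial eigenvalues of $X\in M$ are $\pm\sqrt{a_1},\ldots,\pm\sqrt{a_n}$ (in addition there is one forced zero for $\imath\mathrm o(2n+1)$ and $\nu$ forced zeros for $M_\nu$); $a=(a_1,\ldots,a_n)\in\mathbb R_+^n$ are called the squared singular values of $X$. Notation: $\Delta_n(x)=\prod_{1\le b<c\le n}(x_c-x_b)$; $\mathcal H_\nu f(s)=\Gamma[\nu+1]\int_0^\infty f(x)\frac{J_\nu(2\sqrt{xs})}{(sx)^{\nu/2}}dx$ with $J_\nu$ the Bessel function (at $s=0$ by continuity); derivatives of $\mathcal H_\nu\omega(t)$ at $t=0$ are taken from $t\ge0$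 where necessary. $L^1_\nu(\mathbb R_+)$ is the set of $f\in L^1(\mathbb R_+)$ that are non-negative, $2(n-1)$-times differentiable, satisfy $\int_0^\infty\left|x^{\kappa-1}\left(x^\nu\partial_x x^{1-\nu}\partial_x\right)^jf(x)\right|dx<\infty$ for all $\kappa\in[1,n]$, $j=0,\ldots,n-1$, and $\lim_{x\to0}x^{\nu+1}\partial_x x^{-\nu}\left(\partial_xx^{\nu+1}\partial_xx^{-\nu}\right)^lf(x)=0$ for $l=0,\ldots,n-2$. P\'olya ensemble on $M$ with associated weight $\omega\in L^1_\nu(\mathbb R_+)$: a random matrix in $M$ whose law has a $\mathcal K$-invariant density (with respect to Lebesgue measure) and whose unordered squared singular values have joint probability density on $\mathbb R_+^n$ proportional to $\Delta_n(x)\det[w_b(x_c)]_{b,c=1}^n\ge0$ with $w_j=(x^\nu\partial_xx^{1-\nu}\partial_x)^{j-1}\omega$; note $x^\nu\partial_xx^{1-\nu}\partial_x=\partial_xx^{\nu+1}\partial_xx^{-\nu}$. Description by bi-orthonormal functions: such a density with weights $w_j$ is described by $\{p_j,q_j\}_{j=0,\ldots,n-1}$ if $\int_0^\infty p_l(x)q_m(x)dx=\delta_{lm}$ for $l,m=0,\ldots,n-1$, the linear span of $\{p_j\}$ equals that of $\{x^j\}_{j=0,\ldots,n-1}$, and the linear span of $\{q_j\}$ equals that of $\{w_{j+1}\}_{j=0,\ldots,n-1}$. The corresponding kernel is $K_n(y',y)=\sum_{j=0}^{n-1}p_j(y')q_j(y)$. In the formulas, $\partial_t$ acts on $1/\mathcal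 H_\nu\omega(t)$, operators in $y$ act on $\omega(y)$. *)

theory Defs
  imports
    "HOL-Probability.Probability"
    "Jordan_Normal_Form.Char_Poly"
    "Jordan_Normal_Form.Schur_Decomposition"
begin

hide_const (open) Determinants.det Finite_Cartesian_Product.mat Finite_Cartesian_Product.vec
  Finite_Cartesian_Product.transpose Finite_Cartesian_Product.row
  Finite_Cartesian_Product.column Finite_Cartesian_Product.rows
  Finite_Cartesian_Product.columns
no_notation Finite_Cartesian_Product.vec_nth (infixl "$" 90)


datatype mat_space =
    IO_even        \<comment> \<open>\<open>\<i> o(2n)\<close>\<close>
  | IO_odd         \<comment> \<open>\<open>\<i> o(2n+1)\<close>\<close>
  | IUSP           \<comment> \<open>\<open>\<i> usp(2n)\<close>\<close>
  | Chiral nat     \<comment> \<open>\<open>M\<^sub>\<nu>\<close>\<close>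

fun nu_of :: "mat_space \<Rightarrow> real" where
  "nu_of IO_even = - 1 / 2"
| "nu_of IO_odd = 1 / 2"
| "nu_of IUSP = 1 / 2"
| "nu_of (Chiral k) = real k"

fun mat_size :: "mat_space \<Rightarrow> nat \<Rightarrow> nat" where
  "mat_size IO_even n = 2 * n"
| "mat_size IO_odd n = 2 * n + 1"
| "mat_size IUSP n = 2 * n"
| "mat_size (Chiral k) n = n + (n + k)"

fun forced_zeros :: "mat_space \<Rightarrow> nat" where
  "forced_zeros IO_even = 0"
| "forced_zeros IO_odd = 1"
| "forced_zeros IUSP = 0"
| "forced_zeros (Chiral k) = k"

definition hermitian_mats :: "nat \<Rightarrow> complex mat set" where
  "hermitian_mats m = {X \<in> carrier_mat m m. mat_adjoint X = X}"

definition unitary_mats :: "nat \<Rightarrow> complex mat set" where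
  "unitary_mats m = {k \<in> carrier_mat m m. k * mat_adjoint k = 1\<^sub>m m}"

definition symplectic_unit :: "nat \<Rightarrow> complex mat" where
  "symplectic_unit n = four_block_mat (0\<^sub>m n n) (1\<^sub>m n) (- 1\<^sub>m n) (0\<^sub>m n n)"

text \<open>The dual \<open>J\<^sup>-\<^sup>1 X\<^sup>T J\<close>, where \<open>J\<^sup>-\<^sup>1 = - J\<close>.\<close>

definition symplectic_dual :: "nat \<Rightarrow> complex mat \<Rightarrow> complex mat" where
  "symplectic_dual n X = - symplectic_unit n * transpose_mat X * symplectic_unit n"

fun matrices :: "mat_space \<Rightarrow> nat \<Rightarrow> complex mat set" where
  "matrices IO_even n = {X \<in> hermitian_mats (2 * n). transpose_mat X = - X}"
| "matrices IO_odd n = {X \<in> hermitian_mats (2 * n + 1). transpose_mat X = - X}"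
| "matrices IUSP n = {X \<in> hermitian_mats (2 * n). symplectic_dual n X = - X}"
| "matrices (Chiral k) n =
     {four_block_mat (0\<^sub>m n n) W (mat_adjoint W) (0\<^sub>m (n + k) (n + k)) | W.
        W \<in> carrier_mat n (n + k)}"

fun sym_group :: "mat_space \<Rightarrow> nat \<Rightarrow> complex mat set" where
  "sym_group IO_even n = {k \<in> unitary_mats (2 * n). elements_mat k \<subseteq> \<real>}"
| "sym_group IO_odd n = {k \<in> unitary_mats (2 * n + 1). elements_mat k \<subseteq> \<real>}"
| "sym_group IUSP n = {k \<in> unitary_mats (2 * n).
     transpose_mat k * symplectic_unit n * k = symplectic_unit n}"
| "sym_group (Chiral \<nu>) n =
     {four_block_mat k (0\<^sub>m n (n + \<nu>)) (0\<^sub>m (n + \<nu>) n) l | k l.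
        k \<in> unitary_mats n \<and> l \<in> unitary_mats (n + \<nu>)}"


text \<open>The Borel sets of the matrix space are those generated by the matrix entries.\<close>

definition mat_borel :: "mat_space \<Rightarrow> nat \<Rightarrow> complex mat measure" where
  "mat_borel M n =
     (let I = {..<mat_size M n} \<times> {..<mat_size M n}
      in vimage_algebra (matrices M n) (\<lambda>X. \<lambda>p\<in>I. X $$ p) (\<Pi>\<^sub>M p\<in>I. borel))"

definition real_lincomb :: "nat \<Rightarrow> complex mat list \<Rightarrow> (nat \<Rightarrow> real) \<Rightarrow> complex mat" where
  "real_lincomb m bs c =
     Matrix.mat m m (\<lambda>p. \<Sum>k<length bs. complex_of_real (c k) * (bs ! k) $$ p)"

definition real_basis :: "mat_space \<Rightarrow> nat \<Rightarrow> complex mat list \<Rightarrow> bool" where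
  "real_basis M n bs \<longleftrightarrow> set bs \<subseteq> matrices M n \<and>
     bij_betw (real_lincomb (mat_size M n) bs) ({..<length bs} \<rightarrow>\<^sub>E UNIV) (matrices M n)"

text \<open>Lebesgue measure in the coordinates of a basis. Different bases give proportional measures,
  so having a (\<open>K\<close>-invariant) density does not depend on the basis.\<close>

definition mat_lebesgue :: "mat_space \<Rightarrow> nat \<Rightarrow> complex mat list \<Rightarrow> complex mat measure" where
  "mat_lebesgue M n bs =
     distr (\<Pi>\<^sub>M k\<in>{..<length bs}. lborel) (mat_borel M n) (real_lincomb (mat_size M n) bs)"

definition has_invariant_density :: "mat_space \<Rightarrow> nat \<Rightarrow> complex mat measure \<Rightarrow> bool" where
  "has_invariant_density M n \<mu> \<longleftrightarrow>
     (\<exists>bs f. real_basis M n bs \<and> f \<in> borel_measurable (mat_borel M n) \<and>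
        (\<forall>X\<in>matrices M n. 0 \<le> f X) \<and>
        (\<forall>k\<in>sym_group M n. \<forall>X\<in>matrices M n. f (k * X * mat_adjoint k) = f X) \<and>
        \<mu> = density (mat_lebesgue M n bs) (\<lambda>X. ennreal (f X)))"


text \<open>The squared singular values \<open>a 0 \<le> \<dots> \<le> a (n - 1)\<close>, listed with multiplicity. The multiset
  of all eigenvalues is the multiset of roots of the characteristic polynomial.\<close>

definition sq_sing_vals :: "mat_space \<Rightarrow> nat \<Rightarrow> complex mat \<Rightarrow> nat \<Rightarrow> real" where
  "sq_sing_vals M n X = (THE a. a \<in> {..<n} \<rightarrow>\<^sub>E {0..} \<and> mono_on {..<n} a \<and>
     proots (char_poly X) =
       {# complex_of_real (sqrt (a i)). i \<in># mset_set {..<n} #} +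
       {# - complex_of_real (sqrt (a i)). i \<in># mset_set {..<n} #} +
       replicate_mset (forced_zeros M) 0)"

text \<open>Density of the unordered squared singular values: the law obtained by labelling them in
  uniformly random order has density \<open>p\<close> with respect to Lebesgue measure.\<close>

definition has_unordered_sv_density ::
    "mat_space \<Rightarrow> nat \<Rightarrow> complex mat measure \<Rightarrow> ((nat \<Rightarrow> real) \<Rightarrow> real) \<Rightarrow> bool" where
  "has_unordered_sv_density M n \<mu> p \<longleftrightarrow>
     (\<forall>x. 0 \<le> p x) \<and> p \<in> borel_measurable (\<Pi>\<^sub>M i\<in>{..<n}. borel) \<and>
     (\<forall>B\<in>sets (\<Pi>\<^sub>M i\<in>{..<n}. borel).
        (\<Sum>\<sigma> | \<sigma> permutes {..<n}.
           emeasure \<mu> {X \<in> space \<mu>. (\<lambda>i\<in>{..<n}. sq_sing_vals M n X (\<sigma> i)) \<in> B}) / fact n =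
        (\<integral>\<^sup>+x. ennreal (p x) * indicator B x \<partial>(\<Pi>\<^sub>M i\<in>{..<n}. lborel)))"


text \<open>All functions live on the open half-line \<open>{0<..}\<close>; values at other points are irrelevant.
  \<open>polya_op\<close> is \<open>x\<^sup>\<nu> \<partial>\<^sub>x x\<^sup>1\<^sup>-\<^sup>\<nu> \<partial>\<^sub>x\<close> and \<open>polya_op'\<close> is \<open>\<partial>\<^sub>x x\<^sup>\<nu>\<^sup>+\<^sup>1 \<partial>\<^sub>x x\<^sup>-\<^sup>\<nu>\<close>.\<close>

definition polya_op :: "real \<Rightarrow> (real \<Rightarrow> real) \<Rightarrow> real \<Rightarrow> real" where
  "polya_op \<nu> f x = x powr \<nu> * deriv (\<lambda>y. y powr (1 - \<nu>) * deriv f y) x"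

definition polya_op' :: "real \<Rightarrow> (real \<Rightarrow> real) \<Rightarrow> real \<Rightarrow> real" where
  "polya_op' \<nu> f x = deriv (\<lambda>y. y powr (\<nu> + 1) * deriv (\<lambda>z. z powr (- \<nu>) * f z) y) x"

definition L1_nu :: "nat \<Rightarrow> real \<Rightarrow> (real \<Rightarrow> real) set" where
  "L1_nu n \<nu> = {f. set_integrable lborel {0<..} f \<and> (\<forall>x>0. 0 \<le> f x) \<and>
     (\<forall>k<2 * (n - 1). \<forall>x>0. (deriv ^^ k) f field_differentiable (at x)) \<and>
     (\<forall>\<kappa>\<in>{1..real n}. \<forall>j<n.
        set_integrable lborel {0<..} (\<lambda>x. x powr (\<kappa> - 1) * (polya_op \<nu> ^^ j) f x)) \<and>
     (\<forall>l. l + 2 \<le> n \<longrightarrow>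
        ((\<lambda>x. x powr (\<nu> + 1) * deriv (\<lambda>z. z powr (- \<nu>) * (polya_op' \<nu> ^^ l) f z) x)
           \<longlongrightarrow> 0) (at_right 0))}"

text \<open>Only meaningful for \<open>z > 0\<close>: note that \<open>0 powr 0 = 0\<close>.\<close>

definition bessel_J :: "real \<Rightarrow> real \<Rightarrow> real" where
  "bessel_J \<nu> z = (\<Sum>k. (- 1) ^ k / (fact k * Gamma (\<nu> + real k + 1)) * (z / 2) powr (2 * real k + \<nu>))"

definition hankel_pos :: "real \<Rightarrow> (real \<Rightarrow> real) \<Rightarrow> real \<Rightarrow> real" where
  "hankel_pos \<nu> f s = Gamma (\<nu> + 1) *
     (LINT x:{0<..}|lborel. f x * (bessel_J \<nu> (2 * sqrt (x * s)) / (s * x) powr (\<nu> / 2)))"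

definition hankel :: "real \<Rightarrow> (real \<Rightarrow> real) \<Rightarrow> real \<Rightarrow> real" where
  "hankel \<nu> f s = (if s = 0 then Lim (at_right 0) (hankel_pos \<nu> f) else hankel_pos \<nu> f s)"


definition vandermonde :: "nat \<Rightarrow> (nat \<Rightarrow> real) \<Rightarrow> real" where
  "vandermonde n x = (\<Prod>c<n. \<Prod>b<c. x c - x b)"

text \<open>\<open>polya_weight \<nu> \<omega> j\<close> is \<open>w\<^sub>j\<^sub>+\<^sub>1\<close>: indices are shifted to start from \<open>0\<close>.\<close>

definition polya_weight :: "real \<Rightarrow> (real \<Rightarrow> real) \<Rightarrow> nat \<Rightarrow> real \<Rightarrow> real" where
  "polya_weight \<nu> \<omega> j = (polya_op \<nu> ^^ j) \<omega>"

definition polya_ensemble ::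
    "mat_space \<Rightarrow> nat \<Rightarrow> (real \<Rightarrow> real) \<Rightarrow> complex mat measure \<Rightarrow> bool" where
  "polya_ensemble M n \<omega> \<mu> \<longleftrightarrow>
     \<omega> \<in> L1_nu n (nu_of M) \<and> prob_space \<mu> \<and> has_invariant_density M n \<mu> \<and>
     (let g = (\<lambda>x. vandermonde n x *
                Determinant.det (Matrix.mat n n (\<lambda>(b, c). polya_weight (nu_of M) \<omega> b (x c))))
      in (\<forall>x. (\<forall>i<n. 0 < x i) \<longrightarrow> 0 \<le> g x) \<and>
         (\<exists>C>0. has_unordered_sv_density M n \<mu> (\<lambda>x. if \<forall>i<n. 0 < x i then C * g x else 0)))"

definition polya_density :: "real \<Rightarrow> nat \<Rightarrow> (real \<Rightarrow> real) \<Rightarrow> (nat \<Rightarrow> real) \<Rightarrow> real" where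
  "polya_density \<nu> n \<omega> x =
     (if \<forall>i<n. 0 < x i then
        1 / fact n *
        (\<Prod>j<n. Gamma (\<nu> + 1) / (hankel \<nu> \<omega> 0 * fact j * Gamma (\<nu> + real j + 1))) *
        vandermonde n x *
        Determinant.det (Matrix.mat n n (\<lambda>(a, b). (polya_op' \<nu> ^^ b) \<omega> (x a)))
      else 0)"


text \<open>The restriction to \<open>{0<..}\<close> makes two spans equal iff they agree as function spaces there.\<close>

definition span_on_pos :: "nat \<Rightarrow> (nat \<Rightarrow> real \<Rightarrow> real) \<Rightarrow> (real \<Rightarrow> real) set" where
  "span_on_pos n f = range (\<lambda>c. \<lambda>x\<in>{0<..}. \<Sum>j<n. c j * f j x)"

definition described_by ::
    "nat \<Rightarrow> (nat \<Rightarrow> real \<Rightarrow> real) \<Rightarrow> (nat \<Rightarrow> real \<Rightarrow> real) \<Rightarrow> (nat \<Rightarrow> real \<Rightarrow> real) \<Rightarrow> bool" where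
  "described_by n w p q \<longleftrightarrow>
     (\<forall>l<n. \<forall>m<n. set_integrable lborel {0<..} (\<lambda>x. p l x * q m x) \<and>
        (LINT x:{0<..}|lborel. p l x * q m x) = (if l = m then 1 else 0)) \<and>
     span_on_pos n p = span_on_pos n (\<lambda>j x. x ^ j) \<and>
     span_on_pos n q = span_on_pos n w"

definition biorth_kernel ::
    "nat \<Rightarrow> (nat \<Rightarrow> real \<Rightarrow> real) \<Rightarrow> (nat \<Rightarrow> real \<Rightarrow> real) \<Rightarrow> real \<Rightarrow> real \<Rightarrow> real" where
  "biorth_kernel n p q y' y = (\<Sum>j<n. p j y' * q j y)"


text \<open>\<open>mixed_op \<nu> r\<close> is the operator \<open>r - \<partial>\<^sub>t y\<^sup>-\<^sup>\<nu> \<partial>\<^sub>y y\<^sup>\<nu>\<^sup>+\<^sup>1 \<partial>\<^sub>y\<close> on functions of \<open>t \<ge> 0\<close> and \<open>y > 0\<close>;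
  the derivative in \<open>t\<close> is taken within \<open>{0..}\<close>, hence one-sided at \<open>0\<close>.\<close>

definition mixed_op :: "real \<Rightarrow> real \<Rightarrow> (real \<Rightarrow> real \<Rightarrow> real) \<Rightarrow> real \<Rightarrow> real \<Rightarrow> real" where
  "mixed_op \<nu> r F t y = r * F t y -
     vector_derivative
       (\<lambda>s. y powr (- \<nu>) * deriv (\<lambda>u. u powr (\<nu> + 1) * deriv (\<lambda>v. F s v) u) y)
       (at t within {0..})"

definition p_integrand ::
    "real \<Rightarrow> nat \<Rightarrow> (real \<Rightarrow> real) \<Rightarrow> nat \<Rightarrow> real \<Rightarrow> real \<Rightarrow> real" where
  "p_integrand \<nu> n \<omega> j y' r =
     exp (- r) * (Gamma (\<nu> + 1) / (fact (n - 1) * fact j * Gamma (\<nu> + real j + 1)) *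
       (mixed_op \<nu> r ^^ (n - 1)) (\<lambda>t v. v ^ j / hankel \<nu> \<omega> t) 0 y')"

definition p_fun :: "real \<Rightarrow> nat \<Rightarrow> (real \<Rightarrow> real) \<Rightarrow> nat \<Rightarrow> real \<Rightarrow> real" where
  "p_fun \<nu> n \<omega> j y' = (LINT r:{0<..}|lborel. p_integrand \<nu> n \<omega> j y' r)"

definition q_fun :: "real \<Rightarrow> (real \<Rightarrow> real) \<Rightarrow> nat \<Rightarrow> real \<Rightarrow> real" where
  "q_fun \<nu> \<omega> j = (polya_op' \<nu> ^^ j) \<omega>"

definition laguerre :: "nat \<Rightarrow> real \<Rightarrow> real poly" where
  "laguerre k \<alpha> =
     (\<Sum>i\<le>k. Polynomial.monom ((- 1) ^ i * ((real k + \<alpha>) gchoose (k - i)) / fact i) i)"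

definition monic_laguerre :: "nat \<Rightarrow> real \<Rightarrow> real poly" where
  "monic_laguerre k \<alpha> = Polynomial.smult (inverse (lead_coeff (laguerre k \<alpha>))) (laguerre k \<alpha>)"

text \<open>\<open>poly_of_op P c T f = P(c T) f\<close> for a scalar \<open>c\<close> and an operator \<open>T\<close>.\<close>

definition poly_of_op ::
    "real poly \<Rightarrow> real \<Rightarrow> ((real \<Rightarrow> real) \<Rightarrow> real \<Rightarrow> real) \<Rightarrow> (real \<Rightarrow> real) \<Rightarrow> real \<Rightarrow> real" where
  "poly_of_op P c T f y = (\<Sum>i\<le>degree P. poly.coeff P i * c ^ i * (T ^^ i) f y)"

definition kernel_integrand ::
    "real \<Rightarrow> nat \<Rightarrow> (real \<Rightarrow> real) \<Rightarrow> real \<Rightarrow> real \<Rightarrow> real \<Rightarrow> real \<Rightarrow> real" where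
  "kernel_integrand \<nu> n \<omega> y' y r R =
     R ^ (n - 1) * exp (- r - R) *
     (mixed_op \<nu> r ^^ (n - 1))
       (\<lambda>t v. 1 / hankel \<nu> \<omega> t *
          poly_of_op (monic_laguerre (n - 1) \<nu>) (- (v / R)) (polya_op' \<nu>) \<omega> y) 0 y'"

end

theory Submission
  imports Defs
begin

text \<open>
The whole statement rests on one triangular matrix. Write \<open>T\<close> for the operator
\<open>\<partial> x\<^sup>\<nu>\<^sup>+\<^sup>1 \<partial> x\<^sup>-\<^sup>\<nu>\<close>. Its formal adjoint sends \<open>x\<^sup>a\<close> to \<open>a (a + \<nu>) x\<^sup>a\<^sup>-\<^sup>1\<close>, and the conditions
defining the class of weights are what makes all boundary terms vanish. Hence
\<open>\<integral> x\<^sup>a T\<^sup>b \<omega>\<close> is \<open>0\<close> for \<open>b > a\<close> and otherwise an explicit multiple of the moment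
\<open>\<integral> x\<^sup>a\<^sup>-\<^sup>b \<omega>\<close> (\<open>moment_polya_op'\<close>, \<open>moment_T\<close>).

\<^item> The normalization: by the Andreief identity (\<open>andreief\<close>) the integral of the Vandermonde
  determinant times \<open>det [T\<^sup>b \<omega> (x\<^sub>c)]\<close> is \<open>n!\<close> times the determinant of this triangular matrix. The
  proportionality constant of the ensemble is determined by total mass \<open>1\<close>, which yields the
  asserted constant and, as a by-product, \<open>\<integral> \<omega> \<noteq> 0\<close>
  (\<open>unordered_sv_density_eq_polya_density\<close>).

\<^item> The Hankel transform generates the moments: its \<open>k\<close>-th derivative at \<open>0\<close> is \<open>(-1)\<^sup>k\<close> times the
  \<open>k\<close>-th moment divided by \<open>(\<nu> + 1)\<cdots>(\<nu> + k)\<close>. Differentiation under the integral sign needs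
  only the moments of order less than \<open>n\<close>, because the normalized Bessel function is bounded by
  \<open>1\<close> on the half-line for \<open>\<nu> \<ge> - 1/2\<close> (\<open>abs_bessel_entire_le_1\<close>, \<open>hankel_deriv_DERIV\<close>).

\<^item> Bi-orthonormality is the Leibniz rule for \<open>h \<cdot> (1/h) = 1\<close> at \<open>0\<close>, where \<open>h\<close> is the Hankel
  transform. The binomial theorem for the powers of the mixed operator
  (\<open>mixed_op_funpow\<close>), followed by the integral in \<open>r\<close>, turns \<open>p\<^sub>j\<close> into a polynomial whose
  coefficients are Taylor coefficients of \<open>1/h\<close>. Paired with \<open>T\<^sup>m \<omega>\<close> these give exactly the
  Cauchy product of the Taylor series of \<open>1/h\<close> and \<open>h\<close> (\<open>p_q_integral\<close>).

\<^item> The kernel formula is linear algebra on top of this: the mixed operator is linear in the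
  polynomial it acts on, so the \<open>k\<close>-th term of the Laguerre polynomial produces the integrand of
  \<open>p\<^sub>k\<close> times \<open>R\<^sup>n\<^sup>-\<^sup>1\<^sup>-\<^sup>k e\<^sup>-\<^sup>R\<close>, and the integral in \<open>R\<close> cancels the Laguerre coefficient up to
  factors not depending on \<open>k\<close> (\<open>kernel_integrand_eq\<close>, \<open>monic_laguerre\<close>).
\<close>

section \<open>The Bessel function as an entire function\<close>

text \<open>This is the hypergeometric function \<open>\<^sub>0F\<^sub>1(; b; - z)\<close>. In terms of the Bessel function it is
  \<open>\<Gamma>(\<nu> + 1) J\<^sub>\<nu>(2 \<surd>z) / z\<^sup>\<nu>\<^sup>/\<^sup>2\<close> with \<open>b = \<nu> + 1\<close>, the kernel of the Hankel transform; the power series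
  removes the apparent singularity at \<open>0\<close>.\<close>

definition bessel_entire :: "real \<Rightarrow> real \<Rightarrow> real" where
  "bessel_entire b z = (\<Sum>k. (- 1) ^ k / (fact k * pochhammer b k) * z ^ k)"

lemma pochhammer_ge_half:
  fixes b :: real
  assumes "b \<ge> 1/2"
  shows "pochhammer b k \<ge> 1/2"
proof (induction k)
  case (Suc k)
  show ?case
  proof (cases k)
    case 0
    then show ?thesis using assms by simp
  next
    case (Suc m)
    then have "b + real k \<ge> 1" using assms by simp
    with Suc.IH have "1/2 * 1 \<le> pochhammer b k * (b + real k)"
      by (intro mult_mono) auto
    then show ?thesis by (simp add: pochhammer_Suc)
  qed
qed simp

lemma bessel_entire_summable:
  fixes b :: real
  assumes "b \<ge> 1/2"
  shows "summable (\<lambda>k. (- 1) ^ k / (fact k * pochhammer b k) * z ^ k)"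
proof (rule summable_comparison_test')
  show "summable (\<lambda>k. 2 * (inverse (fact k) * \<bar>z\<bar> ^ k))"
    by (intro summable_mult summable_exp)
  show "norm ((- 1) ^ k / (fact k * pochhammer b k) * z ^ k) \<le> 2 * (inverse (fact k) * \<bar>z\<bar> ^ k)" for k
  proof -
    have p: "pochhammer b k \<ge> 1/2" by (rule pochhammer_ge_half[OF assms])
    then have "inverse (pochhammer b k) \<le> inverse (1/2)"
      by (intro le_imp_inverse_le) auto
    then have "inverse (pochhammer b k) * (inverse (fact k) * \<bar>z\<bar> ^ k) \<le> 2 * (inverse (fact k) * \<bar>z\<bar> ^ k)"
      by (intro mult_right_mono) auto
    moreover have "norm ((- 1) ^ k / (fact k * pochhammer b k) * z ^ k) =
        inverse (pochhammer b k) * (inverse (fact k) * \<bar>z\<bar> ^ k)"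
      using p by (simp add: abs_mult power_abs divide_simps)
    ultimately show ?thesis by simp
  qed
qed

lemma bessel_entire_0 [simp]: "bessel_entire b 0 = 1"
  unfolding bessel_entire_def using suminf_finite[of "{0}" "\<lambda>k. (- 1) ^ k / (fact k * pochhammer b k) * 0 ^ k"]
  by (auto simp: power_0_left)

lemma bessel_entire_DERIV:
  assumes b: "b \<ge> 1/2"
  shows "(bessel_entire b has_field_derivative - bessel_entire (b + 1) z / b) (at z)"
proof -
  let ?c = "\<lambda>b k. (- 1) ^ k / (fact k * pochhammer b k) :: real"
  have "((\<lambda>z. \<Sum>k. ?c b k * z ^ k) has_field_derivative (\<Sum>k. diffs (?c b) k * z ^ k)) (at z)"
    by (rule termdiffs_strong_converges_everywhere) (rule bessel_entire_summable[OF b])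
  moreover have "diffs (?c b) k * z ^ k = (- 1 / b) * (?c (b + 1) k * z ^ k)" for k
  proof -
    have "pochhammer b (Suc k) = b * pochhammer (b + 1) k" by (rule pochhammer_rec)
    then show ?thesis using b by (simp add: diffs_def divide_simps)
  qed
  then have "(\<Sum>k. diffs (?c b) k * z ^ k) = (- 1 / b) * bessel_entire (b + 1) z"
    unfolding bessel_entire_def using b suminf_mult[OF bessel_entire_summable[of "b + 1" z], of "- 1 / b"] by simp
  ultimately show ?thesis unfolding bessel_entire_def[abs_def] by simp
qed

text \<open>By \<open>bessel_entire_DERIV\<close> a shift of the parameter is a derivative up to a factor, so this is
  Bessel's equation \<open>z f'' + b f' + f = 0\<close>.\<close>

lemma bessel_entire_contiguous:
  assumes b: "b \<ge> 1/2"
  shows "z * bessel_entire (b + 2) z / (b * (b + 1)) - bessel_entire (b + 1) z + bessel_entire b z = 0"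
proof -
  let ?c = "\<lambda>b k. (- 1) ^ k / (fact k * pochhammer b k) :: real"
  have sp: "bessel_entire a z = 1 + (\<Sum>k. ?c a (Suc k) * z ^ Suc k)" if "a \<ge> 1/2" for a
    unfolding bessel_entire_def using suminf_split_head[OF bessel_entire_summable[OF that]] by simp
  have su: "summable (\<lambda>k. ?c a (Suc k) * z ^ Suc k)" if "a \<ge> 1/2" for a
    using bessel_entire_summable[OF that] by (subst summable_Suc_iff)
  have co: "?c (b + 1) (Suc k) * z ^ Suc k - ?c b (Suc k) * z ^ Suc k =
      z / (b * (b + 1)) * (?c (b + 2) k * z ^ k)" for k
  proof -
    define P where "P = pochhammer (b + 1) k"
    have P: "P > 0" unfolding P_def using pochhammer_ge_half[of "b + 1" k] b by simp
    have 1: "pochhammer b (Suc k) = b * P" unfolding P_def by (rule pochhammer_rec)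
    have 2: "pochhammer (b + 1) (Suc k) = P * (b + 1 + real k)"
      unfolding P_def by (simp add: pochhammer_Suc)
    have 3: "(b + 1) * pochhammer (b + 2) k = P * (b + 1 + real k)"
      unfolding 2[symmetric] by (subst pochhammer_rec) (simp add: add.assoc)
    have 4: "pochhammer (b + 2) k = P * (b + 1 + real k) / (b + 1)"
      using 3 b by (simp add: field_simps)
    have k: "b + 1 + real k > 0" using b by simp
    show ?thesis unfolding 1 2 4 using P k b
      by (simp add: divide_simps) (simp add: algebra_simps)
  qed
  have "bessel_entire (b + 1) z - bessel_entire b z = (\<Sum>k. ?c (b + 1) (Suc k) * z ^ Suc k) - (\<Sum>k. ?c b (Suc k) * z ^ Suc k)"
    using b by (simp only: sp)
  also have "\<dots> = (\<Sum>k. ?c (b + 1) (Suc k) * z ^ Suc k - ?c b (Suc k) * z ^ Suc k)"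
    using b by (intro suminf_diff su) auto
  also have "\<dots> = (\<Sum>k. z / (b * (b + 1)) * (?c (b + 2) k * z ^ k))"
    unfolding co ..
  also have "\<dots> = z / (b * (b + 1)) * bessel_entire (b + 2) z"
    unfolding bessel_entire_def using b by (intro suminf_mult bessel_entire_summable) auto
  finally show ?thesis by simp
qed

text \<open>For a solution \<open>f\<close> of \<open>z f'' + b f' + f = 0\<close> the energy \<open>f\<^sup>2 + z f'\<^sup>2\<close> has derivative
  \<open>(1 - 2 b) f'\<^sup>2\<close>. It therefore decreases when \<open>b \<ge> 1/2\<close>, that is \<open>\<nu> \<ge> - 1/2\<close>, and it starts at \<open>1\<close>.\<close>

lemma abs_bessel_entire_le_1:
  assumes b: "b \<ge> 1/2" and z: "z \<ge> 0"
  shows "\<bar>bessel_entire b z\<bar> \<le> 1"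
proof -
  define E where "E = (\<lambda>z. (bessel_entire b z)\<^sup>2 + z * (bessel_entire (b + 1) z / b)\<^sup>2)"
  have "E z \<le> E 0"
  proof (rule DERIV_nonpos_imp_nonincreasing[OF z])
    fix x :: real assume "0 \<le> x"
    define u v w where "u = bessel_entire b x" and "v = bessel_entire (b + 1) x" and "w = bessel_entire (b + 2) x"
    have D1: "(bessel_entire (b + 1) has_field_derivative - w / (b + 1)) (at x)"
      using bessel_entire_DERIV[of "b + 1" x] b by (simp add: w_def add.assoc)
    have D0: "(bessel_entire b has_field_derivative - v / b) (at x)"
      using bessel_entire_DERIV[of b x] b by (simp add: v_def)
    define c where "c = b + 1"
    have c: "c > 0" "b > 0" using b by (auto simp: c_def)
    have "b + 2 = c + 1" by (simp add: c_def)
    then have xw: "x * w = (v - u) * (b * c)"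
      using bessel_entire_contiguous[OF b, of x] c
      by (simp add: u_def v_def w_def flip: c_def) (simp add: field_simps)
    have "(E has_real_derivative 2 * u * (- v / b) + ((v / b)\<^sup>2 + x * (2 * (v / b) * (- w / c / b)))) (at x)"
      unfolding E_def using c
      by (auto intro!: derivative_eq_intros D0 D1[folded c_def] simp: u_def v_def mult_ac simp flip: c_def)
    moreover have "2 * u * (- v / b) + ((v / b)\<^sup>2 + x * (2 * (v / b) * (- w / c / b)))
        = 2 * u * (- v / b) + (v / b)\<^sup>2 - 2 * (v / b) * (x * w) / (b * c)"
      by (simp add: mult_ac)
    moreover have "\<dots> = (v / b)\<^sup>2 * (1 - 2 * b)"
      unfolding xw using c by (simp add: field_simps power2_eq_square)
    moreover have "\<dots> \<le> 0" using b by (intro mult_nonneg_nonpos) auto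
    ultimately show "\<exists>y. (E has_real_derivative y) (at x) \<and> y \<le> 0" by metis
  qed
  then have "(bessel_entire b z)\<^sup>2 \<le> 1"
    using mult_nonneg_nonneg[OF z zero_le_power2[of "bessel_entire (b + 1) z / b"]] by (simp add: E_def)
  then show ?thesis by (simp add: abs_square_le_1)
qed

text \<open>The constant \<open>2\<close> bounds \<open>1/b\<close>.\<close>

lemma bessel_entire_lipschitz:
  assumes b: "b \<ge> 1/2" and z: "y \<ge> 0" "z \<ge> 0"
  shows "\<bar>bessel_entire b y - bessel_entire b z\<bar> \<le> 2 * \<bar>y - z\<bar>"
proof -
  have "norm (bessel_entire b y - bessel_entire b z) \<le> 2 * norm (y - z)"
  proof (rule field_differentiable_bound[of "{0..}"])
    show "(bessel_entire b has_field_derivative - bessel_entire (b + 1) x / b) (at x within {0..})" for x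
      by (rule has_field_derivative_at_within[OF bessel_entire_DERIV[OF b]])
    show "norm (- bessel_entire (b + 1) x / b) \<le> 2" if "x \<in> {0..}" for x
    proof -
      have "\<bar>bessel_entire (b + 1) x\<bar> \<le> 1" using that b by (intro abs_bessel_entire_le_1) auto
      then show ?thesis using b by (simp add: divide_simps)
    qed
  qed (use z in auto)
  then show ?thesis by simp
qed

lemma continuous_on_bessel_entire: "b \<ge> 1/2 \<Longrightarrow> continuous_on A (bessel_entire b)"
  by (meson DERIV_isCont bessel_entire_DERIV continuous_at_imp_continuous_on)

lemma bessel_entire_measurable [measurable]: "b \<ge> 1/2 \<Longrightarrow> bessel_entire b \<in> borel_measurable borel"
  by (intro borel_measurable_continuous_onI continuous_on_bessel_entire)

lemma bessel_J_eq_bessel_entire: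
  assumes \<nu>: "\<nu> \<ge> - 1/2" and s: "x > 0"
  shows "Gamma (\<nu> + 1) * (bessel_J \<nu> (2 * sqrt x) / x powr (\<nu> / 2)) = bessel_entire (\<nu> + 1) x"
proof -
  let ?c = "\<lambda>k. (- 1) ^ k / (fact k * pochhammer (\<nu> + 1) k) * x ^ k :: real"
  have G: "Gamma (\<nu> + 1) > 0" using \<nu> by (intro Gamma_real_pos) auto
  have t: "(- 1) ^ k / (fact k * Gamma (\<nu> + real k + 1)) * (2 * sqrt x / 2) powr (2 * real k + \<nu>)
      = x powr (\<nu> / 2) / Gamma (\<nu> + 1) * ?c k" for k
  proof -
    have "\<nu> + 1 \<notin> \<int>\<^sub>\<le>\<^sub>0" using \<nu> nonpos_Ints_nonpos[of "\<nu> + 1"] by auto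
    then have "Gamma (\<nu> + 1 + real k) = pochhammer (\<nu> + 1) k * Gamma (\<nu> + 1)"
      using G pochhammer_Gamma[of "\<nu> + 1" k] by simp
    then have 1: "Gamma (\<nu> + real k + 1) = pochhammer (\<nu> + 1) k * Gamma (\<nu> + 1)"
      by (simp add: algebra_simps)
    have "(2 * sqrt x / 2) powr (2 * real k + \<nu>) = x powr (real k + \<nu> / 2)"
      using s by (simp add: powr_half_sqrt[symmetric] powr_powr field_simps)
    also have "\<dots> = x ^ k * x powr (\<nu> / 2)"
      using s by (simp add: powr_add powr_realpow)
    finally show ?thesis unfolding 1 by (simp add: mult_ac)
  qed
  have "bessel_J \<nu> (2 * sqrt x) = x powr (\<nu> / 2) / Gamma (\<nu> + 1) * bessel_entire (\<nu> + 1) x"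
    unfolding bessel_J_def t bessel_entire_def using \<nu> by (intro suminf_mult bessel_entire_summable) auto
  then show ?thesis using G s by simp
qed

section \<open>Derivatives of the Hankel transform\<close>

lemma bessel_transform_integrable:
  fixes g :: "real \<Rightarrow> real"
  assumes b: "b \<ge> 1/2" and g: "integrable lborel g" and g0: "\<And>x. x \<le> 0 \<Longrightarrow> g x = 0" and t: "t \<ge> 0"
  shows "integrable lborel (\<lambda>x. g x * bessel_entire b (x * t))"
proof (rule Bochner_Integration.integrable_bound[OF g])
  have [measurable]: "g \<in> borel_measurable borel" using g by auto
  show "(\<lambda>x. g x * bessel_entire b (x * t)) \<in> borel_measurable lborel"
    using b by measurable
  show "AE x in lborel. norm (g x * bessel_entire b (x * t)) \<le> norm (g x)"
  proof (rule AE_I2)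
    fix x
    show "norm (g x * bessel_entire b (x * t)) \<le> norm (g x)"
    proof (cases "x \<le> 0")
      case False
      then have "\<bar>bessel_entire b (x * t)\<bar> \<le> 1" using t b by (intro abs_bessel_entire_le_1) auto
      then show ?thesis by (simp add: abs_mult mult_left_le)
    qed (simp add: g0)
  qed
qed

lemma bessel_transform_continuous:
  fixes g :: "real \<Rightarrow> real"
  assumes b: "b \<ge> 1/2" and g: "integrable lborel g" and g0: "\<And>x. x \<le> 0 \<Longrightarrow> g x = 0"
  shows "((\<lambda>s. LINT x|lborel. g x * bessel_entire b (x * s)) \<longlongrightarrow> (LINT x|lborel. g x * bessel_entire b (x * t))) (at t within {0..})"
  unfolding tendsto_at_iff_sequentially comp_def
proof (intro allI impI)
  fix X :: "nat \<Rightarrow> real"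
  assume X: "\<forall>i. X i \<in> {0..} - {t}" "X \<longlonglongrightarrow> t"
  have [measurable]: "g \<in> borel_measurable borel" using g by auto
  show "(\<lambda>i. LINT x|lborel. g x * bessel_entire b (x * X i)) \<longlonglongrightarrow> (LINT x|lborel. g x * bessel_entire b (x * t))"
  proof (rule integral_dominated_convergence[where w = "\<lambda>x. \<bar>g x\<bar>"])
    show "integrable lborel (\<lambda>x. \<bar>g x\<bar>)" using g by simp
    show "AE x in lborel. (\<lambda>i. g x * bessel_entire b (x * X i)) \<longlonglongrightarrow> g x * bessel_entire b (x * t)"
      by (intro AE_I2 tendsto_intros isCont_tendsto_compose[OF DERIV_isCont[OF bessel_entire_DERIV[OF b]]] X)
    show "AE x in lborel. norm (g x * bessel_entire b (x * X i)) \<le> \<bar>g x\<bar>" for i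
    proof (rule AE_I2)
      fix x
      show "norm (g x * bessel_entire b (x * X i)) \<le> \<bar>g x\<bar>"
      proof (cases "x \<le> 0")
        case False
        then have "\<bar>bessel_entire b (x * X i)\<bar> \<le> 1" using X(1) b by (intro abs_bessel_entire_le_1) auto
        then show ?thesis by (simp add: abs_mult mult_left_le)
      qed (simp add: g0)
    qed
  qed (use b in measurable)
qed

text \<open>The difference quotients of \<open>s \<mapsto> bessel_entire b (x s)\<close> are at most \<open>2 x\<close>, uniformly in \<open>s\<close>, so
  dominated convergence costs one additional moment of \<open>g\<close> and no more. A Taylor estimate would cost
  two, which would be one too many for the highest derivative of the Hankel transform of a weight.\<close>

lemma bessel_transform_DERIV:
  fixes g :: "real \<Rightarrow> real"
  assumes b: "b \<ge> 1/2" and g: "integrable lborel g" and g1: "integrable lborel (\<lambda>x. x * g x)"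
    and g0: "\<And>x. x \<le> 0 \<Longrightarrow> g x = 0" and t: "t \<ge> 0"
  shows "((\<lambda>s. LINT x|lborel. g x * bessel_entire b (x * s)) has_real_derivative
    (- 1 / b) * (LINT x|lborel. x * g x * bessel_entire (b + 1) (x * t))) (at t within {0..})"
  unfolding has_field_derivative_iff tendsto_at_iff_sequentially comp_def
proof (intro allI impI)
  fix X :: "nat \<Rightarrow> real"
  assume X: "\<forall>i. X i \<in> {0..} - {t}" "X \<longlonglongrightarrow> t"
  have [measurable]: "g \<in> borel_measurable borel" using g by auto
  have b1: "b + 1 \<ge> 1/2" using b by simp
  let ?s = "\<lambda>i x. g x * ((bessel_entire b (x * X i) - bessel_entire b (x * t)) / (X i - t))"
  let ?f = "\<lambda>x. g x * (x * (- bessel_entire (b + 1) (x * t) / b))"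
  have "(\<lambda>i. LINT x|lborel. ?s i x) \<longlonglongrightarrow> (LINT x|lborel. ?f x)"
  proof (rule integral_dominated_convergence[where w = "\<lambda>x. 2 * \<bar>x * g x\<bar>"])
    show "integrable lborel (\<lambda>x. 2 * \<bar>x * g x\<bar>)" using g1 by (intro integrable_mult_right integrable_abs)
    show "AE x in lborel. (\<lambda>i. ?s i x) \<longlonglongrightarrow> ?f x"
    proof (intro AE_I2 tendsto_mult tendsto_const)
      fix x
      have "((\<lambda>s. bessel_entire b (x * s)) has_real_derivative x * (- bessel_entire (b + 1) (x * t) / b)) (at t)"
        using DERIV_chain2[OF bessel_entire_DERIV[OF b] DERIV_cmult_Id[of x t UNIV]] by (simp add: mult.commute)
      then have "((\<lambda>s. (bessel_entire b (x * s) - bessel_entire b (x * t)) / (s - t)) \<longlongrightarrow> x * (- bessel_entire (b + 1) (x * t) / b)) (at t)"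
        by (simp add: has_field_derivative_iff)
      then show "(\<lambda>i. (bessel_entire b (x * X i) - bessel_entire b (x * t)) / (X i - t)) \<longlonglongrightarrow> x * (- bessel_entire (b + 1) (x * t) / b)"
        unfolding tendsto_at_iff_sequentially comp_def using X by auto
    qed
    show "AE x in lborel. norm (?s i x) \<le> 2 * \<bar>x * g x\<bar>" for i
    proof (rule AE_I2)
      fix x
      have i: "X i \<noteq> t" "X i \<ge> 0" using X(1) by auto
      show "norm (?s i x) \<le> 2 * \<bar>x * g x\<bar>"
      proof (cases "x \<le> 0")
        case False
        then have "\<bar>bessel_entire b (x * X i) - bessel_entire b (x * t)\<bar> \<le> 2 * \<bar>x * X i - x * t\<bar>"
          using i t b by (intro bessel_entire_lipschitz) auto
        also have "\<dots> = 2 * x * \<bar>X i - t\<bar>"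
          using False by (simp add: abs_mult flip: right_diff_distrib)
        finally have "\<bar>bessel_entire b (x * X i) - bessel_entire b (x * t)\<bar> / \<bar>X i - t\<bar> \<le> 2 * x"
          using i by (simp add: divide_simps)
        from mult_left_mono[OF this, of "\<bar>g x\<bar>"] show ?thesis
          using False by (simp add: abs_mult mult_ac)
      qed (simp add: g0)
    qed
  qed (use b b1 in measurable)
  moreover have "(LINT x|lborel. ?s i x) =
      ((LINT x|lborel. g x * bessel_entire b (x * X i)) - (LINT x|lborel. g x * bessel_entire b (x * t))) / (X i - t)" for i
  proof -
    have "(LINT x|lborel. ?s i x) =
        (LINT x|lborel. (g x * bessel_entire b (x * X i) - g x * bessel_entire b (x * t)) / (X i - t))"
      by (simp add: right_diff_distrib)
    also have "\<dots> = (LINT x|lborel. g x * bessel_entire b (x * X i) - g x * bessel_entire b (x * t)) / (X i - t)"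
      by simp
    also have "(LINT x|lborel. g x * bessel_entire b (x * X i) - g x * bessel_entire b (x * t)) =
        (LINT x|lborel. g x * bessel_entire b (x * X i)) - (LINT x|lborel. g x * bessel_entire b (x * t))"
      using X(1) t by (intro Bochner_Integration.integral_diff bessel_transform_integrable b g g0) auto
    finally show ?thesis .
  qed
  moreover have "(LINT x|lborel. ?f x) = (- 1 / b) * (LINT x|lborel. x * g x * bessel_entire (b + 1) (x * t))"
    unfolding integral_mult_right_zero[symmetric] by (rule Bochner_Integration.integral_cong) auto
  ultimately show "(\<lambda>i. ((LINT x|lborel. g x * bessel_entire b (x * X i)) - (LINT x|lborel. g x * bessel_entire b (x * t))) / (X i - t))
      \<longlonglongrightarrow> (- 1 / b) * (LINT x|lborel. x * g x * bessel_entire (b + 1) (x * t))" by (simp only:)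
qed

lemma hankel_eq_bessel_transform:
  assumes \<nu>: "\<nu> \<ge> - 1/2" and f: "set_integrable lborel {0<..} f" and s: "s \<ge> 0"
  shows "hankel \<nu> f s = (LINT x|lborel. indicator {0<..} x * f x * bessel_entire (\<nu> + 1) (x * s))"
proof -
  have pos: "hankel_pos \<nu> f s = (LINT x|lborel. indicator {0<..} x * f x * bessel_entire (\<nu> + 1) (x * s))" if "s > 0" for s
    unfolding hankel_pos_def set_lebesgue_integral_def integral_mult_right_zero[symmetric]
  proof (rule Bochner_Integration.integral_cong[OF refl])
    fix x :: real
    have "Gamma (\<nu> + 1) * (bessel_J \<nu> (2 * sqrt (x * s)) / (s * x) powr (\<nu> / 2)) = bessel_entire (\<nu> + 1) (x * s)" if "x > 0"
      using bessel_J_eq_bessel_entire[OF \<nu>, of "x * s"] that \<open>s > 0\<close> by (simp add: mult.commute)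
    then have "f x * (Gamma (\<nu> + 1) * (bessel_J \<nu> (2 * sqrt (x * s)) / (s * x) powr (\<nu> / 2))) = f x * bessel_entire (\<nu> + 1) (x * s)"
      if "x > 0" using that by simp
    then show "Gamma (\<nu> + 1) * indicator {0<..} x *\<^sub>R (f x * (bessel_J \<nu> (2 * sqrt (x * s)) / (s * x) powr (\<nu> / 2))) =
        indicator {0<..} x * f x * bessel_entire (\<nu> + 1) (x * s)"
      by (auto simp: indicator_def mult.left_commute)
  qed
  show ?thesis
  proof (cases "s = 0")
    case True
    let ?K = "\<lambda>s. LINT x|lborel. indicator {0<..} x * f x * bessel_entire (\<nu> + 1) (x * s)"
    have "(?K \<longlongrightarrow> ?K 0) (at 0 within {0..})"
      using \<nu> f by (intro bessel_transform_continuous) (auto simp: set_integrable_def)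
    then have "(?K \<longlongrightarrow> ?K 0) (at_right 0)"
      by (rule tendsto_within_subset) auto
    then have "(hankel_pos \<nu> f \<longlongrightarrow> ?K 0) (at_right 0)"
      by (rule Lim_transform_eventually) (auto simp: eventually_at_filter pos)
    then have "Lim (at_right 0) (hankel_pos \<nu> f) = ?K 0"
      by (intro tendsto_Lim) auto
    then show ?thesis using True by (simp add: hankel_def)
  qed (use s pos in \<open>simp add: hankel_def\<close>)
qed

section \<open>Boundary terms on the half-line\<close>

text \<open>The derivative \<open>f\<close> need not be continuous: the highest derivative of a weight is only known to
  exist and to be integrable. On compact intervals the Henstock-Kurzweil integral recovers \<open>F\<close> from any
  everywhere defined derivative, and integrability of \<open>f\<close> identifies it with the Lebesgue integral.\<close>

lemma half_line_FTC:
  fixes F f :: "real \<Rightarrow> real"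
  assumes D: "\<And>x. x > 0 \<Longrightarrow> (F has_real_derivative f x) (at x)"
    and I: "set_integrable lborel {0<..} f"
  obtains L0 L where "(F \<longlongrightarrow> L0) (at_right 0)" "(F \<longlongrightarrow> L) at_top"
    "(LINT x:{0<..}|lborel. f x) = L - L0"
proof -
  have sub: "set_integrable lborel A f" if "A \<subseteq> {0<..}" "A \<in> sets borel" for A
    using that by (intro set_integrable_subset[OF I]) auto
  have ftc: "(LINT x:{s..t}|lborel. f x) = F t - F s" if "0 < s" "s \<le> t" for s t
  proof -
    have "(f has_integral (F t - F s)) {s..t}"
      using that by (intro fundamental_theorem_of_calculus)
        (auto simp: has_real_derivative_iff_has_vector_derivative[symmetric]
          intro!: has_field_derivative_at_within D)
    moreover have "set_integrable lborel {s..t} f" using that by (intro sub) auto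
    ultimately show ?thesis by (simp add: set_borel_integral_eq_integral(2) integral_unique)
  qed
  let ?A = "LINT x:{0<..1}|lborel. f x" and ?B = "LINT x:{1..}|lborel. f x"
  have "((\<lambda>s. LINT x:{s..1}|lborel. f x) \<longlongrightarrow> ?A) (at_right 0)"
    by (rule tendsto_set_lebesgue_integral_at_right) (auto intro!: sub)
  then have "((\<lambda>s. F 1 - (LINT x:{s..1}|lborel. f x)) \<longlongrightarrow> F 1 - ?A) (at_right 0)"
    by (intro tendsto_intros)
  moreover have "\<forall>\<^sub>F s in at_right 0. F 1 - (LINT x:{s..1}|lborel. f x) = F s"
    using eventually_at_right_real[of 0 1] by (auto elim!: eventually_mono simp: ftc)
  ultimately have 0: "(F \<longlongrightarrow> F 1 - ?A) (at_right 0)" by (rule Lim_transform_eventually)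
  have "((\<lambda>t. LINT x:{1..t}|lborel. f x) \<longlongrightarrow> ?B) at_top"
    by (rule tendsto_set_lebesgue_integral_at_top) (auto intro!: sub)
  then have "((\<lambda>t. F 1 + (LINT x:{1..t}|lborel. f x)) \<longlongrightarrow> F 1 + ?B) at_top"
    by (intro tendsto_intros)
  moreover have "\<forall>\<^sub>F t in at_top. F 1 + (LINT x:{1..t}|lborel. f x) = F t"
    using eventually_ge_at_top[of 1] by eventually_elim (simp add: ftc)
  ultimately have 1: "(F \<longlongrightarrow> F 1 + ?B) at_top" by (rule Lim_transform_eventually)
  have "{0<..} = {0<..1} \<union> {1::real..}" by auto
  moreover have "(LINT x:{0<..1} \<union> {1..}|lborel. f x) = ?A + ?B"
  proof (rule set_integral_Un_AE)
    show "AE x in lborel. \<not> (x \<in> {0<..1} \<and> x \<in> {1::real..})"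
      using AE_lborel_singleton[of "1::real"] by (auto elim!: eventually_mono)
  qed (auto intro!: sub)
  ultimately show ?thesis by (intro that[OF 0 1]) simp
qed

lemma half_line_primitive:
  fixes u :: "real \<Rightarrow> real"
  assumes "continuous_on {0<..} u" "set_integrable lborel {0<..} u"
  obtains U L0 L where "\<And>x. x > 0 \<Longrightarrow> (U has_real_derivative u x) (at x)"
    "(U \<longlongrightarrow> L0) (at_right 0)" "(U \<longlongrightarrow> L) at_top"
proof -
  have "\<exists>U. \<forall>x::real. ereal 0 < x \<longrightarrow> x < \<infinity> \<longrightarrow> (U has_vector_derivative u x) (at x)"
    using assms(1) by (intro einterval_antiderivative) (auto simp: continuous_on_eq_continuous_at)
  then obtain U where U: "\<And>x. x > 0 \<Longrightarrow> (U has_real_derivative u x) (at x)"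
    by (auto simp: has_real_derivative_iff_has_vector_derivative)
  from half_line_FTC[OF U assms(2)] that[OF U] show ?thesis by metis
qed

text \<open>For a primitive \<open>U\<close> of \<open>u\<close>, l'Hopital's rule gives \<open>U x / x \<rightarrow> l\<close>, while \<open>U\<close> itself converges.\<close>

lemma integrable_limit_at_top_zero:
  fixes u :: "real \<Rightarrow> real"
  assumes "continuous_on {0<..} u" "set_integrable lborel {0<..} u" "(u \<longlongrightarrow> l) at_top"
  shows "l = 0"
proof -
  obtain U L0 L where U: "\<And>x. x > 0 \<Longrightarrow> (U has_real_derivative u x) (at x)" "(U \<longlongrightarrow> L) at_top"
    using half_line_primitive[OF assms(1,2)] by metis
  have "((\<lambda>x. U x / x) \<longlongrightarrow> l) at_top"
  proof (rule lhospital_at_top_at_top)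
    show "\<forall>\<^sub>F x in at_top. (U has_real_derivative u x) (at x)"
      using eventually_gt_at_top[of 0] by eventually_elim (rule U)
    show "\<forall>\<^sub>F x in at_top. ((\<lambda>x. x) has_real_derivative 1) (at x)" by (auto intro!: always_eventually)
    show "((\<lambda>x. u x / 1) \<longlongrightarrow> l) at_top" using assms(3) by simp
  qed (auto intro: filterlim_ident)
  moreover have "((\<lambda>x. U x / x) \<longlongrightarrow> 0) at_top"
    by (rule real_tendsto_divide_at_top[OF U(2)]) (rule filterlim_ident)
  ultimately show ?thesis by (metis tendsto_unique trivial_limit_at_top_linorder)
qed

text \<open>The same comparison at the origin, now of a primitive with the logarithm.\<close>

lemma integrable_times_limit_at_0_zero:
  fixes w :: "real \<Rightarrow> real"
  assumes "continuous_on {0<..} w" "set_integrable lborel {0<..} w"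
    and lim: "((\<lambda>x. x * w x) \<longlongrightarrow> l) (at_right 0)"
  shows "l = 0"
proof -
  obtain U L0 L where U: "\<And>x. x > 0 \<Longrightarrow> (U has_real_derivative w x) (at x)" "(U \<longlongrightarrow> L0) (at_right 0)"
    using half_line_primitive[OF assms(1,2)] by metis
  have pos: "\<forall>\<^sub>F x in at_right 0. x > (0::real)" by (simp add: eventually_at_right_less)
  have ln: "filterlim (\<lambda>x::real. - ln x) at_top (at_right 0)"
    using ln_at_0 by (simp add: filterlim_uminus_at_top)
  have "((\<lambda>x. U x / (- ln x)) \<longlongrightarrow> - l) (at_right 0)"
  proof (rule lhopital_right_0_at_top[OF ln])
    show "\<forall>\<^sub>F x in at_right 0. - (1 / x) \<noteq> (0::real)" using pos by eventually_elim auto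
    show "\<forall>\<^sub>F x in at_right 0. (U has_real_derivative w x) (at x)"
      using pos by eventually_elim (rule U)
    show "\<forall>\<^sub>F x in at_right 0. ((\<lambda>x. - ln x) has_real_derivative - (1 / x)) (at x)"
      using pos by eventually_elim (auto intro!: derivative_eq_intros)
    have "((\<lambda>x. - (x * w x)) \<longlongrightarrow> - l) (at_right 0)" using lim by (rule tendsto_minus)
    then show "((\<lambda>x. w x / - (1 / x)) \<longlongrightarrow> - l) (at_right 0)"
      by (simp add: mult.commute)
  qed
  moreover have "((\<lambda>x. U x / (- ln x)) \<longlongrightarrow> 0) (at_right 0)"
    by (rule real_tendsto_divide_at_top[OF U(2) ln])
  ultimately have "- l = 0"
    by (intro tendsto_unique[OF trivial_limit_at_right_real])
  then show ?thesis by simp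
qed

text \<open>The boundary term at infinity in the integration by parts below has the form \<open>x u' - c u\<close> with
  \<open>u\<close> integrable. With a primitive \<open>U\<close> of \<open>u\<close> it is the derivative of \<open>x u - (c + 1) U\<close>, so a limit \<open>l\<close>
  of this term forces \<open>u \<rightarrow> l\<close> by l'Hopital's rule, since \<open>U x / x \<rightarrow> 0\<close>.\<close>

lemma euler_limit_at_top_zero:
  fixes u u' :: "real \<Rightarrow> real"
  assumes u: "\<And>x. x > 0 \<Longrightarrow> (u has_real_derivative u' x) (at x)"
    and I: "set_integrable lborel {0<..} u"
    and lim: "((\<lambda>x. x * u' x - c * u x) \<longlongrightarrow> l) at_top"
  shows "l = 0"
proof -
  have cont: "continuous_on {0<..} u"
    by (auto intro!: continuous_at_imp_continuous_on DERIV_isCont u)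
  obtain U L0 L where U: "\<And>x. x > 0 \<Longrightarrow> (U has_real_derivative u x) (at x)" "(U \<longlongrightarrow> L) at_top"
    using half_line_primitive[OF cont I] by metis
  define V where "V = (\<lambda>x. x * u x - (c + 1) * U x)"
  have "((\<lambda>x. V x / x) \<longlongrightarrow> l) at_top"
  proof (rule lhospital_at_top_at_top)
    show "\<forall>\<^sub>F x in at_top. (V has_real_derivative (x * u' x - c * u x)) (at x)"
      using eventually_gt_at_top[of 0] unfolding V_def
      by eventually_elim (auto intro!: derivative_eq_intros u U simp: algebra_simps)
    show "\<forall>\<^sub>F x in at_top. ((\<lambda>x. x) has_real_derivative 1) (at x)" by (auto intro!: always_eventually)
    show "((\<lambda>x. (x * u' x - c * u x) / 1) \<longlongrightarrow> l) at_top" using lim by simp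
  qed (auto intro: filterlim_ident)
  moreover have "((\<lambda>x. U x / x) \<longlongrightarrow> 0) at_top"
    by (rule real_tendsto_divide_at_top[OF U(2)]) (rule filterlim_ident)
  ultimately have "((\<lambda>x. V x / x + (c + 1) * (U x / x)) \<longlongrightarrow> l + (c + 1) * 0) at_top"
    by (intro tendsto_intros)
  moreover have "\<forall>\<^sub>F x in at_top. V x / x + (c + 1) * (U x / x) = u x"
    using eventually_gt_at_top[of 0] by eventually_elim (simp add: V_def field_simps)
  ultimately have "(u \<longlongrightarrow> l) at_top"
    using Lim_transform_eventually by fastforce
  then show ?thesis using integrable_limit_at_top_zero[OF cont I] by blast
qed

section \<open>The Polya operator and moments\<close>

lemma deriv_eq_on_pos:
  fixes f g :: "real \<Rightarrow> real"
  assumes "\<And>x. x > 0 \<Longrightarrow> f x = g x" "x > 0"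
  shows "deriv f x = deriv g x"
proof (rule deriv_cong_ev)
  show "\<forall>\<^sub>F y in nhds x. f y = g y"
    using eventually_nhds_in_open[of "{0<..}" x] assms by (auto elim!: eventually_mono)
qed simp

lemma has_real_derivative_eq_on_pos:
  fixes f g :: "real \<Rightarrow> real"
  assumes "(f has_real_derivative d) (at x)" "x > 0" "\<And>x. x > 0 \<Longrightarrow> f x = g x"
  shows "(g has_real_derivative d) (at x)"
  by (rule DERIV_cong_ev[THEN iffD1, OF refl _ refl assms(1)])
    (use eventually_nhds_in_open[of "{0<..}" x] assms(2,3) in \<open>auto elim!: eventually_mono\<close>)

definition times_diff :: "nat \<Rightarrow> (real \<Rightarrow> real) \<Rightarrow> bool" where
  "times_diff k f \<longleftrightarrow> (\<forall>i<k. \<forall>x>0. (deriv ^^ i) f field_differentiable (at x))"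

lemma times_diff_0 [simp]: "times_diff 0 f"
  by (simp add: times_diff_def)

lemma times_diff_Suc:
  "times_diff (Suc k) f \<longleftrightarrow> (\<forall>x>0. f field_differentiable (at x)) \<and> times_diff k (deriv f)"
proof -
  have "(\<forall>i<Suc k. \<forall>x>0. (deriv ^^ i) f field_differentiable (at x)) \<longleftrightarrow>
     (\<forall>x>0. f field_differentiable (at x)) \<and>
     (\<forall>i<k. \<forall>x>0. (deriv ^^ Suc i) f field_differentiable (at x))"
    unfolding less_Suc_eq_0_disj by auto
  then show ?thesis unfolding times_diff_def by (simp add: funpow_Suc_right del: funpow.simps)
qed

lemma times_diff_mono: "times_diff k f \<Longrightarrow> l \<le> k \<Longrightarrow> times_diff l f"
  by (auto simp: times_diff_def)

lemma times_diff_DERIV: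
  "times_diff (Suc k) f \<Longrightarrow> x > 0 \<Longrightarrow> (f has_real_derivative deriv f x) (at x)"
  by (auto simp: times_diff_Suc field_differentiable_derivI)

lemma times_diff_cong:
  assumes "\<And>x. x > 0 \<Longrightarrow> f x = g x" "times_diff k f"
  shows "times_diff k g"
  using assms
proof (induction k arbitrary: f g)
  case (Suc k)
  have "times_diff k (deriv g)"
  proof (rule Suc.IH)
    show "deriv f x = deriv g x" if "x > 0" for x
      by (rule deriv_eq_on_pos[OF Suc.prems(1) that])
    show "times_diff k (deriv f)" using Suc.prems(2) by (simp add: times_diff_Suc)
  qed
  moreover have "g field_differentiable (at x)" if "x > 0" for x
    using has_real_derivative_eq_on_pos[OF times_diff_DERIV[OF Suc.prems(2) that] that Suc.prems(1)]
    unfolding field_differentiable_def by blast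
  ultimately show ?case by (simp add: times_diff_Suc)
qed simp

lemma times_diff_SucI:
  assumes "\<And>x. x > 0 \<Longrightarrow> (f has_real_derivative f' x) (at x)" "times_diff k f'"
  shows "times_diff (Suc k) f"
  unfolding times_diff_Suc
proof (intro conjI allI impI)
  show "f field_differentiable (at x)" if "x > 0" for x
    using assms(1)[OF that] unfolding field_differentiable_def by blast
  show "times_diff k (deriv f)"
    by (rule times_diff_cong[OF _ assms(2)]) (metis assms(1) DERIV_imp_deriv)
qed

lemma times_diff_add:
  assumes "times_diff k f" "times_diff k g"
  shows "times_diff k (\<lambda>x. f x + g x)"
  using assms
proof (induction k arbitrary: f g)
  case (Suc k)
  have "times_diff k (\<lambda>x. deriv f x + deriv g x)"
    by (rule Suc.IH) (use Suc.prems in \<open>auto simp: times_diff_Suc\<close>)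
  then show ?case
    by (rule times_diff_SucI[rotated]) (auto intro!: derivative_eq_intros times_diff_DERIV Suc.prems)
qed simp

lemma times_diff_cmult:
  assumes "times_diff k f"
  shows "times_diff k (\<lambda>x. c * f x)"
  using assms
proof (induction k arbitrary: f)
  case (Suc k)
  have "times_diff k (\<lambda>x. c * deriv f x)"
    by (rule Suc.IH) (use Suc.prems in \<open>auto simp: times_diff_Suc\<close>)
  then show ?case
    by (rule times_diff_SucI[rotated]) (auto intro!: derivative_eq_intros times_diff_DERIV Suc.prems)
qed simp

lemma times_diff_ident_mult:
  assumes "times_diff k f"
  shows "times_diff k (\<lambda>x. x * f x)"
  using assms
proof (induction k arbitrary: f)
  case (Suc k)
  have "times_diff k (\<lambda>x. x * deriv f x)"
    by (rule Suc.IH) (use Suc.prems in \<open>auto simp: times_diff_Suc\<close>)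
  then have "times_diff k (\<lambda>x. f x + x * deriv f x)"
    by (intro times_diff_add times_diff_mono[OF Suc.prems]) auto
  then show ?case
    by (rule times_diff_SucI[rotated])
      (auto intro!: derivative_eq_intros times_diff_DERIV[OF Suc.prems])
qed simp

lemma DERIV_powr_times:
  assumes "x > 0" "(f has_real_derivative d) (at x)"
  shows "((\<lambda>y. y powr a * f y) has_real_derivative a * x powr (a - 1) * f x + x powr a * d) (at x)"
  using assms by (auto intro!: derivative_eq_intros simp: algebra_simps)

lemma polya_op_eq:
  assumes "times_diff 2 f" "x > 0"
  shows "polya_op \<nu> f x = x * deriv (deriv f) x + (1 - \<nu>) * deriv f x"
proof -
  have "((\<lambda>y. y powr (1 - \<nu>) * deriv f y) has_real_derivative
      (1 - \<nu>) * x powr (- \<nu>) * deriv f x + x powr (1 - \<nu>) * deriv (deriv f) x) (at x)"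
    using DERIV_powr_times[of x "deriv f" "deriv (deriv f) x" "1 - \<nu>"] assms
      times_diff_DERIV[of 0 "deriv f" x] by (simp add: times_diff_Suc numeral_2_eq_2)
  then have "polya_op \<nu> f x = x powr \<nu> *
      ((1 - \<nu>) * x powr (- \<nu>) * deriv f x + x powr (1 - \<nu>) * deriv (deriv f) x)"
    unfolding polya_op_def by (simp add: DERIV_imp_deriv)
  also have "\<dots> = (1 - \<nu>) * (x powr \<nu> * x powr (- \<nu>)) * deriv f x + (x powr \<nu> * x powr (1 - \<nu>)) * deriv (deriv f) x"
    by (simp add: algebra_simps)
  also have "\<dots> = x * deriv (deriv f) x + (1 - \<nu>) * deriv f x"
    using assms(2) by (simp flip: powr_add)
  finally show ?thesis .
qed

text \<open>Since \<open>polya_op' \<nu> f\<close> is the derivative of this expression, it is the flux that appears as a boundary term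
  when the operator is moved to the other factor.\<close>

lemma polya_flux_eq:
  assumes "times_diff 1 f" "x > 0"
  shows "x powr (\<nu> + 1) * deriv (\<lambda>z. z powr (- \<nu>) * f z) x = x * deriv f x - \<nu> * f x"
proof -
  have "((\<lambda>z. z powr (- \<nu>) * f z) has_real_derivative
      - \<nu> * x powr (- \<nu> - 1) * f x + x powr (- \<nu>) * deriv f x) (at x)"
    using DERIV_powr_times[of x f "deriv f x" "- \<nu>"] assms times_diff_DERIV[of 0 f x] by simp
  then have "x powr (\<nu> + 1) * deriv (\<lambda>z. z powr (- \<nu>) * f z) x =
      x powr (\<nu> + 1) * (- \<nu> * x powr (- \<nu> - 1) * f x + x powr (- \<nu>) * deriv f x)"
    by (simp add: DERIV_imp_deriv)
  also have "\<dots> = - \<nu> * (x powr (\<nu> + 1) * x powr (- \<nu> - 1)) * f x + (x powr (\<nu> + 1) * x powr (- \<nu>)) * deriv f x"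
    by (simp add: algebra_simps)
  also have "\<dots> = x * deriv f x - \<nu> * f x"
    using assms(2) by (simp flip: powr_add)
  finally show ?thesis .
qed

lemma polya_op'_eq:
  assumes "times_diff 2 f" "x > 0"
  shows "polya_op' \<nu> f x = x * deriv (deriv f) x + (1 - \<nu>) * deriv f x"
proof -
  have 1: "times_diff 1 f" "times_diff 1 (deriv f)"
    using assms by (auto simp: times_diff_Suc numeral_2_eq_2)
  have "polya_op' \<nu> f x = deriv (\<lambda>y. y * deriv f y - \<nu> * f y) x"
    unfolding polya_op'_def by (rule deriv_eq_on_pos[OF polya_flux_eq[OF 1(1)] assms(2)])
  also have "\<dots> = x * deriv (deriv f) x + (1 - \<nu>) * deriv f x"
    using times_diff_DERIV[OF 1(1)[unfolded One_nat_def] assms(2)] times_diff_DERIV[OF 1(2)[unfolded One_nat_def] assms(2)]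
    by (intro DERIV_imp_deriv) (auto intro!: derivative_eq_intros simp: algebra_simps)
  finally show ?thesis .
qed

lemma times_diff_polya_op':
  assumes "times_diff (k + 2) f"
  shows "times_diff k (polya_op' \<nu> f)"
proof -
  have d: "times_diff (Suc k) (deriv f)" "times_diff k (deriv (deriv f))" and 2: "times_diff 2 f"
    using assms times_diff_mono[OF assms, of 2] by (auto simp: times_diff_Suc numeral_2_eq_2)
  have "times_diff k (\<lambda>x. x * deriv (deriv f) x + (1 - \<nu>) * deriv f x)"
    by (intro times_diff_add times_diff_ident_mult times_diff_cmult d(2) times_diff_mono[OF d(1)]) simp
  then show ?thesis by (rule times_diff_cong[rotated]) (simp add: polya_op'_eq[OF 2])
qed

lemma times_diff_polya_op'_funpow:
  "times_diff (k + 2 * j) f \<Longrightarrow> times_diff k ((polya_op' \<nu> ^^ j) f)"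
  by (induction j arbitrary: k) (auto intro!: times_diff_polya_op')

lemma polya_op_cong_pos:
  assumes "\<And>x. x > 0 \<Longrightarrow> f x = g x" "x > 0"
  shows "polya_op \<nu> f x = polya_op \<nu> g x"
proof -
  have "deriv (\<lambda>y. y powr (1 - \<nu>) * deriv f y) x = deriv (\<lambda>y. y powr (1 - \<nu>) * deriv g y) x"
    by (rule deriv_eq_on_pos[OF _ assms(2)]) (simp add: deriv_eq_on_pos[OF assms(1)])
  then show ?thesis by (simp add: polya_op_def)
qed

lemma polya_op_funpow_eq:
  assumes "times_diff (2 * j) f" "x > 0"
  shows "(polya_op \<nu> ^^ j) f x = (polya_op' \<nu> ^^ j) f x"
  using assms
proof (induction j arbitrary: x)
  case (Suc j)
  have 2: "times_diff 2 ((polya_op' \<nu> ^^ j) f)"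
    using times_diff_polya_op'_funpow[of 2 j f \<nu>] Suc.prems by simp
  have "polya_op \<nu> ((polya_op \<nu> ^^ j) f) x = polya_op \<nu> ((polya_op' \<nu> ^^ j) f) x"
    using Suc by (intro polya_op_cong_pos Suc.IH times_diff_mono[OF Suc.prems(1)]) auto
  then show ?case
    by (simp add: polya_op_eq[OF 2 Suc.prems(2)] polya_op'_eq[OF 2 Suc.prems(2)])
qed simp

text \<open>Two integrations by parts, carried out at once with the primitive
  \<open>F = x\<^sup>a (x f' - \<nu> f) - a x\<^sup>a f\<close>. Both limits of \<open>F\<close> exist because its derivative is integrable. At
  infinity \<open>F\<close> has the form treated in \<open>euler_limit_at_top_zero\<close> with \<open>u = x\<^sup>a f\<close>. At the origin the flux
  condition removes the first summand, and a nonzero limit of \<open>a x\<^sup>a f\<close> would contradict the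
  integrability of \<open>x\<^sup>a\<^sup>-\<^sup>1 f\<close>; for \<open>a = 0\<close> this summand is absent.\<close>

lemma moment_polya_op':
  assumes f: "times_diff 2 f"
    and I: "\<And>a. a \<le> N \<Longrightarrow> set_integrable lborel {0<..} (\<lambda>x. x ^ a * f x)"
    and I': "\<And>a. a \<le> N \<Longrightarrow> set_integrable lborel {0<..} (\<lambda>x. x ^ a * polya_op' \<nu> f x)"
    and flux: "((\<lambda>x. x powr (\<nu> + 1) * deriv (\<lambda>z. z powr (- \<nu>) * f z) x) \<longlongrightarrow> 0) (at_right 0)"
    and a: "a \<le> N"
  shows "(LINT x:{0<..}|lborel. x ^ a * polya_op' \<nu> f x) =
    real a * (real a + \<nu>) * (LINT x:{0<..}|lborel. x ^ (a - 1) * f x)"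
proof -
  have D1: "(f has_real_derivative deriv f x) (at x)"
    and D2: "(deriv f has_real_derivative deriv (deriv f) x) (at x)" if "x > 0" for x
    using f that times_diff_DERIV[of 1 f] times_diff_DERIV[of 0 "deriv f"]
    by (auto simp: numeral_2_eq_2 times_diff_Suc)
  have f1: "times_diff 1 f" by (rule times_diff_mono[OF f]) simp
  define F where "F = (\<lambda>x. x ^ a * (x * deriv f x - \<nu> * f x) - real a * (x ^ a * f x))"
  define F' where "F' = (\<lambda>x. x ^ a * polya_op' \<nu> f x - real a * (real a + \<nu>) * (x ^ (a - 1) * f x))"
  have pw: "real a * x ^ (a - 1) * x = real a * x ^ a" for x :: real
    by (cases a) auto
  have DF: "(F has_real_derivative F' x) (at x)" if "x > 0" for x
  proof -
    have "(F has_real_derivative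
       (real a * x ^ (a - 1) * (x * deriv f x - \<nu> * f x) + x ^ a * (deriv f x + x * deriv (deriv f) x - \<nu> * deriv f x)
         - real a * (real a * x ^ (a - 1) * f x + x ^ a * deriv f x))) (at x)"
      unfolding F_def
      by (rule derivative_eq_intros D1 D2 that refl)+ (simp add: algebra_simps)
    also have "real a * x ^ (a - 1) * (x * deriv f x - \<nu> * f x) = real a * x ^ a * deriv f x - real a * \<nu> * x ^ (a - 1) * f x"
      unfolding pw[of x, symmetric] by (simp add: algebra_simps)
    finally show ?thesis
      unfolding F'_def polya_op'_eq[OF f that] by (rule back_subst[of "\<lambda>d. (F has_real_derivative d) (at x)"]) (simp add: algebra_simps)
  qed
  have IF1: "set_integrable lborel {0<..} (\<lambda>x. x ^ (a - 1) * f x)" using a by (intro I) simp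
  have IF2: "set_integrable lborel {0<..} (\<lambda>x. real a * (real a + \<nu>) * (x ^ (a - 1) * f x))"
    using IF1 by (rule set_integrable_mult_right)
  have IF': "set_integrable lborel {0<..} F'"
    unfolding F'_def by (intro set_integral_diff(1) I' a IF2)
  obtain L0 L where L: "(F \<longlongrightarrow> L0) (at_right 0)" "(F \<longlongrightarrow> L) at_top"
    "(LINT x:{0<..}|lborel. F' x) = L - L0"
    using half_line_FTC[OF DF IF'] by blast
  have cont: "continuous_on {0<..} f"
    by (auto intro!: continuous_at_imp_continuous_on DERIV_isCont[OF D1])
  have "L = 0"
  proof (rule euler_limit_at_top_zero)
    show "((\<lambda>x. x ^ a * f x) has_real_derivative real a * x ^ (a - 1) * f x + x ^ a * deriv f x) (at x)" if "x > 0" for x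
      by (rule derivative_eq_intros D1 that refl)+ (simp add: algebra_simps)
    show "set_integrable lborel {0<..} (\<lambda>x. x ^ a * f x)" by (rule I[OF a])
    have "F = (\<lambda>x. x * (real a * x ^ (a - 1) * f x + x ^ a * deriv f x) - (2 * real a + \<nu>) * (x ^ a * f x))"
    proof
      fix x :: real
      have "x * (real a * x ^ (a - 1) * f x + x ^ a * deriv f x) = (real a * x ^ (a - 1) * x) * f x + x * x ^ a * deriv f x"
        by (simp add: algebra_simps)
      also have "real a * x ^ (a - 1) * x = real a * x ^ a" by (rule pw)
      finally show "F x = x * (real a * x ^ (a - 1) * f x + x ^ a * deriv f x) - (2 * real a + \<nu>) * (x ^ a * f x)"
        unfolding F_def by (auto simp: algebra_simps)
    qed
    then show "((\<lambda>x. x * (real a * x ^ (a - 1) * f x + x ^ a * deriv f x) - (2 * real a + \<nu>) * (x ^ a * f x)) \<longlongrightarrow> L) at_top"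
      using L(2) by simp
  qed
  moreover have "L0 = 0"
  proof -
    have ev: "\<forall>\<^sub>F x in at_right 0. x > (0::real)" by (simp add: eventually_at_right_less)
    have "((\<lambda>x. x * deriv f x - \<nu> * f x) \<longlongrightarrow> 0) (at_right 0)"
      using flux by (rule Lim_transform_eventually) (use ev in eventually_elim, auto simp: polya_flux_eq[OF f1])
    then have G: "((\<lambda>x. x ^ a * (x * deriv f x - \<nu> * f x)) \<longlongrightarrow> 0 ^ a * 0) (at_right 0)"
      by (intro tendsto_intros)
    have H: "((\<lambda>x. x ^ a * (x * deriv f x - \<nu> * f x) - F x) \<longlongrightarrow> 0 ^ a * 0 - L0) (at_right 0)"
      by (rule tendsto_diff[OF G L(1)])
    have H': "(\<lambda>x. x ^ a * (x * deriv f x - \<nu> * f x) - F x) = (\<lambda>x. x * (real a * x ^ (a - 1) * f x))"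
    proof
      fix x :: real
      have "x * (real a * x ^ (a - 1) * f x) = (real a * x ^ (a - 1) * x) * f x"
        by simp
      also have "real a * x ^ (a - 1) * x = real a * x ^ a" by (rule pw)
      finally show "x ^ a * (x * deriv f x - \<nu> * f x) - F x = x * (real a * x ^ (a - 1) * f x)"
        by (auto simp: F_def)
    qed
    have "0 ^ a * 0 - L0 = 0"
    proof (rule integrable_times_limit_at_0_zero)
      show "((\<lambda>x. x * (real a * x ^ (a - 1) * f x)) \<longlongrightarrow> 0 ^ a * 0 - L0) (at_right 0)"
        using H unfolding H' .
      show "continuous_on {0<..} (\<lambda>x. real a * x ^ (a - 1) * f x)"
        by (intro continuous_intros cont)
      show "set_integrable lborel {0<..} (\<lambda>x. real a * x ^ (a - 1) * f x)"
        using set_integrable_mult_right[of "real a", OF IF1] by (simp add: mult.assoc)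
    qed
    then show ?thesis by simp
  qed
  ultimately have "(LINT x:{0<..}|lborel. F' x) = 0" using L by simp
  then show ?thesis
    unfolding F'_def by (subst (asm) set_integral_diff(2)[OF I'[OF a] IF2]) simp
qed

section \<open>Derivatives of a reciprocal\<close>

text \<open>Pascal's rule in the form shared by the Leibniz rule (for \<open>f i j = g\<^sub>i h\<^sub>j\<close>) and by the binomial
  theorem for operators (for \<open>f i j = r\<^sup>j a\<^sub>i\<close>).\<close>

lemma sum_binomial_Suc:
  fixes f :: "nat \<Rightarrow> nat \<Rightarrow> real"
  shows "(\<Sum>i\<le>Suc k. real (Suc k choose i) * f i (Suc k - i)) =
    (\<Sum>i\<le>k. real (k choose i) * f i (Suc k - i)) + (\<Sum>i\<le>k. real (k choose i) * f (Suc i) (k - i))"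
proof -
  have "(\<Sum>i\<le>k. real (k choose Suc i) * f (Suc i) (k - i)) + f 0 (Suc k) =
      (\<Sum>i\<le>Suc k. real (k choose i) * f i (Suc k - i))"
    by (subst sum.atMost_Suc_shift) simp
  also have "\<dots> = (\<Sum>i\<le>k. real (k choose i) * f i (Suc k - i))"
    by (subst sum.atMost_Suc) simp
  finally show ?thesis
    by (subst sum.atMost_Suc_shift) (simp add: sum.distrib algebra_simps)
qed

text \<open>If \<open>h k\<close> is the \<open>k\<close>-th derivative of \<open>h 0\<close>, then \<open>recip_deriv h m\<close> is the \<open>m\<close>-th derivative of
  \<open>1 / h 0\<close>: the recursion is the Leibniz rule for \<open>h 0 \<cdot> (1 / h 0) = 1\<close>, solved for the top derivative
  of \<open>1 / h 0\<close>. Being an algebraic recursion in the values at one point, it also makes sense for the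
  one-sided derivatives at \<open>0\<close>.\<close>

fun recip_deriv :: "(nat \<Rightarrow> real \<Rightarrow> real) \<Rightarrow> nat \<Rightarrow> real \<Rightarrow> real" where
  "recip_deriv h m t =
     ((if m = 0 then 1 else 0) - (\<Sum>i<m. real (m choose i) * recip_deriv h i t * h (m - i) t)) / h 0 t"

declare recip_deriv.simps [simp del]

lemma recip_deriv_0: "recip_deriv h 0 t = 1 / h 0 t"
  by (subst recip_deriv.simps) simp

lemma recip_deriv_leibniz:
  assumes "h 0 t \<noteq> 0"
  shows "(\<Sum>i\<le>m. real (m choose i) * recip_deriv h i t * h (m - i) t) = (if m = 0 then 1 else 0)"
  using assms by (subst lessThan_Suc_atMost[symmetric], subst sum.lessThan_Suc) (simp add: recip_deriv.simps[of h m])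

text \<open>Differentiating the recursion for \<open>m\<close> and collecting terms with Pascal's rule gives the recursion
  for \<open>m + 1\<close>.\<close>

lemma recip_deriv_DERIV:
  assumes h: "\<And>k s. k < N \<Longrightarrow> s \<in> S \<Longrightarrow> (h k has_real_derivative h (Suc k) s) (at s within S)"
    and t: "t \<in> S" "h 0 t \<noteq> 0" and m: "m < N"
  shows "(recip_deriv h m has_real_derivative recip_deriv h (Suc m) t) (at t within S)"
  using m
proof (induction m rule: less_induct)
  case (less m)
  let ?A = "\<lambda>s. (if m = 0 then 1 else 0) - (\<Sum>i<m. real (m choose i) * recip_deriv h i s * h (m - i) s)"
  let ?A' = "- (\<Sum>i<m. real (m choose i) * (recip_deriv h (Suc i) t * h (m - i) t + recip_deriv h i t * h (Suc m - i) t))"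
  have dh: "(h (m - i) has_real_derivative h (Suc m - i) t) (at t within S)" if "i < m" for i
    using h[of "m - i" t] t that less.prems by (simp add: Suc_diff_le)
  have "(?A has_real_derivative ?A') (at t within S)"
    using less.prems
    by (auto intro!: derivative_eq_intros less.IH dh simp: algebra_simps sum.distrib sum_subtractf sum_negf)
  moreover have "(h 0 has_real_derivative h 1 t) (at t within S)"
    using h[of 0 t] t less.prems by simp
  ultimately have "((\<lambda>s. ?A s / h 0 s) has_real_derivative (?A' * h 0 t - ?A t * h 1 t) / (h 0 t * h 0 t)) (at t within S)"
    by (rule DERIV_divide) (rule t)
  moreover have "(\<lambda>s. ?A s / h 0 s) = recip_deriv h m"
    by (rule ext) (rule recip_deriv.simps[symmetric])
  moreover have "(?A' * h 0 t - ?A t * h 1 t) / (h 0 t * h 0 t) = recip_deriv h (Suc m) t"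
  proof -
    have R: "?A t = recip_deriv h m t * h 0 t" using t by (subst recip_deriv.simps) simp
    have "0 = (\<Sum>i\<le>Suc m. real (Suc m choose i) * (recip_deriv h i t * h (Suc m - i) t))"
      using recip_deriv_leibniz[of h t "Suc m"] t by (simp add: mult.assoc)
    also have "\<dots> = (\<Sum>i\<le>m. real (m choose i) * (recip_deriv h i t * h (Suc m - i) t)) +
        (\<Sum>i\<le>m. real (m choose i) * (recip_deriv h (Suc i) t * h (m - i) t))"
      by (rule sum_binomial_Suc)
    also have "\<dots> = recip_deriv h (Suc m) t * h 0 t + recip_deriv h m t * h 1 t - ?A'"
      by (simp add: lessThan_Suc_atMost[symmetric] sum.distrib algebra_simps)
    finally have "?A' - recip_deriv h m t * h 1 t = recip_deriv h (Suc m) t * h 0 t" by simp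
    moreover have "(?A' * h 0 t - ?A t * h 1 t) / (h 0 t * h 0 t) = (?A' - recip_deriv h m t * h 1 t) / h 0 t"
      unfolding R using t by (simp add: divide_simps) (simp add: algebra_simps)
    ultimately show ?thesis using t by simp
  qed
  ultimately show ?case by simp
qed

section \<open>The mixed operator on polynomials\<close>

text \<open>The formal adjoint \<open>x\<^sup>-\<^sup>\<nu> \<partial> x\<^sup>\<nu>\<^sup>+\<^sup>1 \<partial>\<close> of the Polya operator, acting on polynomials.\<close>

definition adj_poly :: "real \<Rightarrow> real poly \<Rightarrow> real poly" where
  "adj_poly \<nu> P = [:0, 1:] * pderiv (pderiv P) + Polynomial.smult (\<nu> + 1) (pderiv P)"

lemma adj_poly_linear:
  "adj_poly \<nu> (P + Q) = adj_poly \<nu> P + adj_poly \<nu> Q"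
  "adj_poly \<nu> (Polynomial.smult c P) = Polynomial.smult c (adj_poly \<nu> P)"
  "adj_poly \<nu> 0 = 0"
  by (simp_all add: adj_poly_def pderiv_add pderiv_smult smult_add_right algebra_simps)

lemma adj_poly_sum: "adj_poly \<nu> (sum f A) = (\<Sum>i\<in>A. adj_poly \<nu> (f i))"
  by (induction A rule: infinite_finite_induct) (simp_all add: adj_poly_linear)

lemma deriv_poly_on_pos:
  fixes y :: real
  assumes F: "\<And>v. v > 0 \<Longrightarrow> F v = poly P v" and y: "y > 0"
  shows "y powr (- \<nu>) * deriv (\<lambda>u. u powr (\<nu> + 1) * deriv F u) y = poly (adj_poly \<nu> P) y"
proof -
  have nb: "\<forall>\<^sub>F v in nhds u. v > 0" if "u > 0" for u :: real
    using eventually_nhds_in_open[of "{0<..}" u] that by simp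
  have 1: "deriv F u = poly (pderiv P) u" if "u > 0" for u
  proof -
    have "deriv F u = deriv (poly P) u"
      by (rule deriv_cong_ev) (use nb[OF that] F in \<open>auto elim!: eventually_mono\<close>)
    then show ?thesis by (simp add: DERIV_imp_deriv[OF poly_DERIV])
  qed
  have "deriv (\<lambda>u. u powr (\<nu> + 1) * deriv F u) y = deriv (\<lambda>u. u powr (\<nu> + 1) * poly (pderiv P) u) y"
    by (rule deriv_cong_ev) (use nb[OF y] 1 in \<open>auto elim!: eventually_mono\<close>)
  also have "\<dots> = (\<nu> + 1) * y powr \<nu> * poly (pderiv P) y + y powr (\<nu> + 1) * poly (pderiv (pderiv P)) y"
    using y by (intro DERIV_imp_deriv) (auto intro!: derivative_eq_intros simp: algebra_simps)
  finally have "y powr (- \<nu>) * deriv (\<lambda>u. u powr (\<nu> + 1) * deriv F u) y =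
      (\<nu> + 1) * (y powr (- \<nu>) * y powr \<nu>) * poly (pderiv P) y +
      (y powr (- \<nu>) * y powr (\<nu> + 1)) * poly (pderiv (pderiv P)) y"
    by (simp add: algebra_simps)
  also have "\<dots> = poly (adj_poly \<nu> P) y"
    using y by (simp add: adj_poly_def flip: powr_add)
  finally show ?thesis .
qed

text \<open>On a product \<open>g(t) P(y)\<close> the operator is \<open>r - \<partial>\<^sub>t A\<close>, where \<open>\<partial>\<^sub>t\<close> acts on \<open>g\<close> and \<open>A\<close> on the
  polynomial \<open>P\<close>. The scalar \<open>r\<close> commutes with \<open>\<partial>\<^sub>t A\<close>, so the binomial theorem applies. The
  identity has to be carried along on a relatively open set \<open>U\<close> of times, since the next application
  differentiates in \<open>t\<close>. For \<open>g = 1/h\<close> only the set where \<open>h \<noteq> 0\<close> is available.\<close>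

lemma mixed_op_funpow:
  fixes G :: "nat \<Rightarrow> real \<Rightarrow> real"
  assumes U: "U \<subseteq> {0..}" "\<And>t. t \<in> U \<Longrightarrow> \<exists>d>0. \<forall>s\<ge>0. dist s t < d \<longrightarrow> s \<in> U"
    and G: "\<And>i t. i < N \<Longrightarrow> t \<in> U \<Longrightarrow> (G i has_real_derivative G (Suc i) t) (at t within {0..})"
    and F: "\<And>t v. t \<in> U \<Longrightarrow> v > 0 \<Longrightarrow> F t v = G 0 t * poly P v"
    and k: "k \<le> N" and t: "t \<in> U" and y: "y > 0"
  shows "(mixed_op \<nu> r ^^ k) F t y =
    (\<Sum>i\<le>k. real (k choose i) * (r ^ (k - i) * ((- 1) ^ i * G i t * poly ((adj_poly \<nu> ^^ i) P) y)))"
  using k t y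
proof (induction k arbitrary: t y)
  case 0
  then show ?case using F by simp
next
  case (Suc k)
  let ?F = "(mixed_op \<nu> r ^^ k) F"
  let ?c = "\<lambda>i. real (k choose i) * (r ^ (k - i) * (- 1) ^ i)"
  let ?g = "\<lambda>s. \<Sum>i\<le>k. ?c i * G i s * poly ((adj_poly \<nu> ^^ Suc i) P) y"
  have inner: "y powr (- \<nu>) * deriv (\<lambda>u. u powr (\<nu> + 1) * deriv (\<lambda>v. ?F s v) u) y = ?g s" if "s \<in> U" for s
  proof -
    define Q where "Q = (\<Sum>i\<le>k. Polynomial.smult (?c i * G i s) ((adj_poly \<nu> ^^ i) P))"
    have "?F s v = poly Q v" if "v > 0" for v
      using Suc.IH[of s v] Suc.prems that \<open>s \<in> U\<close> by (simp add: Q_def poly_sum mult_ac)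
    from deriv_poly_on_pos[where P = Q, OF this Suc.prems(3)] show ?thesis
      by (simp add: Q_def adj_poly_sum adj_poly_linear poly_sum)
  qed
  have "(?g has_real_derivative (\<Sum>i\<le>k. ?c i * G (Suc i) t * poly ((adj_poly \<nu> ^^ Suc i) P) y)) (at t within {0..})"
    using Suc.prems by (auto intro!: derivative_eq_intros G simp: mult_ac)
  then have gv: "(?g has_vector_derivative (\<Sum>i\<le>k. ?c i * G (Suc i) t * poly ((adj_poly \<nu> ^^ Suc i) P) y)) (at t within {0..})"
    by (simp add: has_real_derivative_iff_has_vector_derivative)
  obtain d where d: "d > 0" "\<And>s. s \<ge> 0 \<Longrightarrow> dist s t < d \<Longrightarrow> s \<in> U"
    using U(2)[OF Suc.prems(2)] by blast
  have t0: "t \<ge> 0" using U(1) Suc.prems by auto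
  have "((\<lambda>s. y powr (- \<nu>) * deriv (\<lambda>u. u powr (\<nu> + 1) * deriv (\<lambda>v. ?F s v) u) y) has_vector_derivative
      (\<Sum>i\<le>k. ?c i * G (Suc i) t * poly ((adj_poly \<nu> ^^ Suc i) P) y)) (at t within {0..})"
    by (rule has_vector_derivative_transform_within[OF gv d(1)]) (use t0 d inner in auto)
  moreover have "at t within {0..} \<noteq> bot"
  proof -
    have "t islimpt {t..t+1}" by (intro islimpt_Icc[THEN iffD2]) auto
    then have "t islimpt {0..}" by (rule islimpt_subset) (use t0 in auto)
    then show ?thesis by (simp add: trivial_limit_within)
  qed
  ultimately have "vector_derivative (\<lambda>s. y powr (- \<nu>) * deriv (\<lambda>u. u powr (\<nu> + 1) * deriv (\<lambda>v. ?F s v) u) y)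
      (at t within {0..}) = (\<Sum>i\<le>k. ?c i * G (Suc i) t * poly ((adj_poly \<nu> ^^ Suc i) P) y)"
    by (intro vector_derivative_within)
  then have "(mixed_op \<nu> r ^^ Suc k) F t y =
      r * ?F t y - (\<Sum>i\<le>k. ?c i * G (Suc i) t * poly ((adj_poly \<nu> ^^ Suc i) P) y)"
    by (simp add: mixed_op_def)
  also have "r * ?F t y = (\<Sum>i\<le>k. real (k choose i) * (r ^ (Suc k - i) * ((- 1) ^ i * G i t * poly ((adj_poly \<nu> ^^ i) P) y)))"
    using Suc by (auto simp: sum_distrib_left Suc_diff_le intro!: sum.cong)
  also have "\<dots> - (\<Sum>i\<le>k. ?c i * G (Suc i) t * poly ((adj_poly \<nu> ^^ Suc i) P) y) = \<dots> +
      (\<Sum>i\<le>k. real (k choose i) * (r ^ (k - i) * ((- 1) ^ Suc i * G (Suc i) t * poly ((adj_poly \<nu> ^^ Suc i) P) y)))"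
    by (simp add: mult_ac flip: sum_negf)
  also have "\<dots> = (\<Sum>i\<le>Suc k. real (Suc k choose i) * (r ^ (Suc k - i) * ((- 1) ^ i * G i t * poly ((adj_poly \<nu> ^^ i) P) y)))"
    by (rule sum_binomial_Suc[symmetric])
  finally show ?case .
qed

text \<open>The scalar in \<open>A\<^sup>b x\<^sup>a = moment_factor \<nu> a b \<cdot> x\<^sup>a\<^sup>-\<^sup>b\<close> for the adjoint \<open>A\<close>. For \<open>b > a\<close> it contains
  the factor \<open>0\<close>, so the truncated subtraction in the recursion is harmless.\<close>

fun moment_factor :: "real \<Rightarrow> nat \<Rightarrow> nat \<Rightarrow> real" where
  "moment_factor \<nu> a 0 = 1"
| "moment_factor \<nu> a (Suc b) = real a * (real a + \<nu>) * moment_factor \<nu> (a - 1) b"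

lemma pochhammer_nu_pos: "\<nu> \<ge> - 1/2 \<Longrightarrow> pochhammer (\<nu> + 1) k > (0::real)"
  by (rule pochhammer_pos) simp

lemma moment_factor_eq:
  assumes \<nu>: "\<nu> \<ge> - 1/2"
  shows "moment_factor \<nu> a b = (if b \<le> a then fact a * pochhammer (\<nu> + 1) a / (fact (a - b) * pochhammer (\<nu> + 1) (a - b)) else 0)"
proof (induction b arbitrary: a)
  case 0
  then show ?case using pochhammer_nu_pos[OF \<nu>, of a] by simp
next
  case (Suc b)
  then show ?case by (cases a) (auto simp: pochhammer_Suc algebra_simps add_divide_distrib)
qed

lemma adj_poly_monom:
  "adj_poly \<nu> (Polynomial.monom 1 j) = Polynomial.smult (real j * (real j + \<nu>)) (Polynomial.monom 1 (j - 1))"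
proof (cases j)
  case 0
  then show ?thesis by (simp add: adj_poly_def pderiv_monom)
next
  case (Suc i)
  then show ?thesis
    by (intro poly_eqI) (cases i; auto simp: adj_poly_def pderiv_monom coeff_pCons algebra_simps split: nat.splits)
qed

lemma adj_poly_funpow_linear:
  "(adj_poly \<nu> ^^ i) (P + Q) = (adj_poly \<nu> ^^ i) P + (adj_poly \<nu> ^^ i) Q"
  "(adj_poly \<nu> ^^ i) (Polynomial.smult c P) = Polynomial.smult c ((adj_poly \<nu> ^^ i) P)"
  "(adj_poly \<nu> ^^ i) 0 = 0"
  by (induction i) (simp_all add: adj_poly_linear)

lemma adj_poly_funpow_sum: "(adj_poly \<nu> ^^ i) (sum f A) = (\<Sum>j\<in>A. (adj_poly \<nu> ^^ i) (f j))"
  by (induction A rule: infinite_finite_induct) (simp_all add: adj_poly_funpow_linear)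

lemma adj_poly_funpow_monom:
  "(adj_poly \<nu> ^^ i) (Polynomial.monom 1 j) = Polynomial.smult (moment_factor \<nu> j i) (Polynomial.monom 1 (j - i))"
proof (induction i arbitrary: j)
  case (Suc i)
  have "(adj_poly \<nu> ^^ Suc i) (Polynomial.monom 1 j) = (adj_poly \<nu> ^^ i) (adj_poly \<nu> (Polynomial.monom 1 j))"
    by (simp only: funpow_Suc_right comp_apply)
  then show ?case by (simp add: adj_poly_monom adj_poly_funpow_linear Suc)
qed simp

section \<open>Vandermonde determinants and the Andreief identity\<close>

text \<open>Replacing the monomials by the monic polynomials \<open>\<Prod>i<b. (X - x\<^sub>i)\<close> multiplies the matrix by a
  unitriangular one and makes it triangular.\<close>

lemma vandermonde_eq_det:
  "vandermonde n x = Determinant.det (Matrix.mat n n (\<lambda>(b, c). x c ^ b))"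
proof -
  define p where "p = (\<lambda>b. \<Prod>i<b. [:- x i, 1:])"
  have deg: "degree (p b) = b" and lead: "coeff (p b) b = 1" for b
  proof -
    show d: "degree (p b) = b" unfolding p_def by (subst degree_prod_eq_sum_degree) auto
    have "lead_coeff (p b) = 1" unfolding p_def by (simp add: lead_coeff_prod)
    then show "coeff (p b) b = 1" using d by simp
  qed
  let ?V = "Matrix.mat n n (\<lambda>(b, c). x c ^ b)"
  define L where "L = Matrix.mat n n (\<lambda>(b, a). coeff (p b) a)"
  define P where "P = Matrix.mat n n (\<lambda>(b, c). poly (p b) (x c))"
  have "P = L * ?V"
  proof (rule eq_matI)
    fix b c assume "b < dim_row (L * ?V)" "c < dim_col (L * ?V)"
    then have bc: "b < n" "c < n" by (auto simp: L_def)
    have "(\<Sum>a\<le>b. coeff (p b) a * x c ^ a) = (\<Sum>a = 0..<n. coeff (p b) a * x c ^ a)"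
      using bc by (intro sum.mono_neutral_left) (auto simp: coeff_eq_0 deg)
    then show "P $$ (b, c) = (L * ?V) $$ (b, c)"
      using bc by (simp add: P_def L_def scalar_prod_def poly_altdef deg)
  qed (auto simp: P_def L_def)
  then have "Determinant.det P = Determinant.det L * Determinant.det ?V"
    by (metis L_def det_mult mat_carrier)
  moreover have "Determinant.det L = 1"
    by (subst det_lower_triangular[of n])
      (auto simp: L_def prod_list_diag_prod coeff_eq_0 deg lead)
  moreover have "Determinant.det P = vandermonde n x"
  proof (subst det_upper_triangular[of _ n])
    show "upper_triangular P"
      by (auto simp: P_def p_def poly_prod upper_triangular_def)
  qed (auto simp: P_def p_def poly_prod prod_list_diag_prod vandermonde_def lessThan_atLeast0)
  ultimately show ?thesis by simp
qed

text \<open>Expanding both determinants and integrating factor by factor leaves, for each permutation \<open>p\<close> of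
  the first expansion, the determinant of the matrix of integrals with rows permuted by \<open>p\<close>; the two
  signs cancel.\<close>

lemma andreief:
  fixes f w :: "nat \<Rightarrow> real \<Rightarrow> real"
  assumes I: "\<And>a b. a < n \<Longrightarrow> b < n \<Longrightarrow> integrable lborel (\<lambda>x. f a x * w b x)"
  shows "has_bochner_integral (\<Pi>\<^sub>M i\<in>{..<n}. lborel)
    (\<lambda>x. Determinant.det (Matrix.mat n n (\<lambda>(b, c). f b (x c))) * Determinant.det (Matrix.mat n n (\<lambda>(b, c). w b (x c))))
    (fact n * Determinant.det (Matrix.mat n n (\<lambda>(a, b). LINT x|lborel. f a x * w b x)))"
proof -
  interpret product_sigma_finite "\<lambda>_::nat. lborel :: real measure" by standard
  define M where "M = Matrix.mat n n (\<lambda>(a, b). LINT x|lborel. f a x * w b x)"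
  let ?S = "{p. p permutes {0..<n}}"
  have lt: "p i < n" if "p \<in> ?S" "i < n" for p i
    using permutes_in_image[of p "{0..<n}" i] that by auto
  have det: "Determinant.det (Matrix.mat n n (\<lambda>(b, c). g b (x c))) =
      (\<Sum>p\<in>?S. signof p * (\<Prod>i\<in>{..<n}. g (p i) (x i)))" for g :: "nat \<Rightarrow> real \<Rightarrow> real" and x
    by (subst mat_det_left_def[of _ n]) (auto simp: lessThan_atLeast0 intro!: sum.cong prod.cong lt)
  have eq: "Determinant.det (Matrix.mat n n (\<lambda>(b, c). f b (x c))) * Determinant.det (Matrix.mat n n (\<lambda>(b, c). w b (x c)))
      = (\<Sum>p\<in>?S. \<Sum>q\<in>?S. signof p * signof q * (\<Prod>i\<in>{..<n}. f (p i) (x i) * w (q i) (x i)))" for x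
    unfolding det by (simp add: sum_product prod.distrib mult_ac)
  have bi: "has_bochner_integral (\<Pi>\<^sub>M i\<in>{..<n}. lborel) (\<lambda>x. \<Sum>p\<in>?S. \<Sum>q\<in>?S. signof p * signof q * (\<Prod>i\<in>{..<n}. f (p i) (x i) * w (q i) (x i)))
     (\<Sum>p\<in>?S. \<Sum>q\<in>?S. signof p * signof q * (\<Prod>i\<in>{..<n}. M $$ (p i, q i)))"
  proof (intro has_bochner_integral_sum has_bochner_integral_mult_right)
    fix p q assume pq: "p \<in> ?S" "q \<in> ?S"
    have i: "integrable lborel (\<lambda>x. f (p i) x * w (q i) x)" if "i \<in> {..<n}" for i
      using that pq lt by (intro I) auto
    show "has_bochner_integral (\<Pi>\<^sub>M i\<in>{..<n}. lborel) (\<lambda>x. \<Prod>i\<in>{..<n}. f (p i) (x i) * w (q i) (x i)) (\<Prod>i\<in>{..<n}. M $$ (p i, q i))"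
      unfolding has_bochner_integral_iff
    proof (intro conjI product_integrable_prod i)
      have "integral\<^sup>L (\<Pi>\<^sub>M i\<in>{..<n}. lborel) (\<lambda>x. \<Prod>i\<in>{..<n}. f (p i) (x i) * w (q i) (x i)) =
          (\<Prod>i\<in>{..<n}. LINT x|lborel. f (p i) x * w (q i) x)"
        by (rule product_integral_prod[OF finite_lessThan i])
      also have "\<dots> = (\<Prod>i\<in>{..<n}. M $$ (p i, q i))"
        using pq by (intro prod.cong refl) (simp add: M_def lt)
      finally show "integral\<^sup>L (\<Pi>\<^sub>M i\<in>{..<n}. lborel) (\<lambda>x. \<Prod>i\<in>{..<n}. f (p i) (x i) * w (q i) (x i)) =
          (\<Prod>i\<in>{..<n}. M $$ (p i, q i))" .
    qed auto
  qed
  have "(\<Sum>q\<in>?S. signof p * signof q * (\<Prod>i\<in>{..<n}. M $$ (p i, q i))) = Determinant.det M" if p: "p \<in> ?S" for p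
  proof -
    have "(\<Sum>q\<in>?S. signof q * (\<Prod>i\<in>{..<n}. M $$ (p i, q i))) =
        Determinant.det (Matrix.mat n n (\<lambda>(i, j). M $$ (p i, j)))"
      using lt by (subst det_def'[of _ n]) (auto simp: lessThan_atLeast0 intro!: sum.cong prod.cong)
    also have "\<dots> = signof p * Determinant.det M"
      using p by (intro det_permute_rows) (auto simp: M_def)
    finally have "signof p * (\<Sum>q\<in>?S. signof q * (\<Prod>i\<in>{..<n}. M $$ (p i, q i))) = (signof p * signof p) * Determinant.det M"
      by simp
    also have "signof p * signof p = (1 :: real)" by (cases "evenperm p") (simp_all add: sign_def)
    finally show ?thesis by (simp only: sum_distrib_left mult.assoc mult_1)
  qed
  then have "(\<Sum>p\<in>?S. \<Sum>q\<in>?S. signof p * signof q * (\<Prod>i\<in>{..<n}. M $$ (p i, q i))) =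
      (\<Sum>p\<in>?S. Determinant.det M)"
    by (rule sum.cong[OF refl])
  also have "\<dots> = fact n * Determinant.det M"
    using card_permutations[of "{0..<n}" n] by simp
  finally have "(\<Sum>p\<in>?S. \<Sum>q\<in>?S. signof p * signof q * (\<Prod>i\<in>{..<n}. M $$ (p i, q i))) =
      fact n * Determinant.det M" .
  with bi show ?thesis unfolding eq M_def by (simp only:)
qed

text \<open>Testing on the whole space: every permutation contributes the total mass of \<open>\<mu>\<close>.\<close>

lemma total_mass_unordered_sv_density:
  assumes "has_unordered_sv_density M n \<mu> p" "prob_space \<mu>"
  shows "(\<integral>\<^sup>+x. ennreal (p x) \<partial>(\<Pi>\<^sub>M i\<in>{..<n}. lborel)) = 1"
proof -
  interpret prob_space \<mu> by fact
  let ?B = "space (\<Pi>\<^sub>M i\<in>{..<n}. borel :: real measure)"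
  have B: "?B \<in> sets (\<Pi>\<^sub>M i\<in>{..<n}. borel)" by (rule sets.top)
  have *: "{X \<in> space \<mu>. (\<lambda>i\<in>{..<n}. sq_sing_vals M n X (\<sigma> i)) \<in> ?B} = space \<mu>" for \<sigma>
    by (auto simp: space_PiM)
  have "(\<integral>\<^sup>+x. ennreal (p x) * indicator ?B x \<partial>(\<Pi>\<^sub>M i\<in>{..<n}. lborel)) =
      (\<Sum>\<sigma> | \<sigma> permutes {..<n}. emeasure \<mu> (space \<mu>)) / fact n"
    using bspec[OF conjunct2[OF conjunct2[OF assms(1)[unfolded has_unordered_sv_density_def]]] B]
    unfolding * by (rule sym)
  also have "\<dots> = of_nat (fact n) / of_nat (fact n)"
    by (simp add: emeasure_space_1 card_permutations)
  also have "\<dots> = (1 :: ennreal)"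
    by (rule ennreal_divide_self) (auto simp: of_nat_less_top simp del: of_nat_fact)
  also have "(\<integral>\<^sup>+x. ennreal (p x) * indicator ?B x \<partial>(\<Pi>\<^sub>M i\<in>{..<n}. lborel)) =
      (\<integral>\<^sup>+x. ennreal (p x) \<partial>(\<Pi>\<^sub>M i\<in>{..<n}. lborel))"
    by (intro nn_integral_cong) (auto simp: space_PiM)
  finally show ?thesis .
qed

section \<open>Gamma and exponential integrals\<close>

lemma has_bochner_integral_power_times_exp:
  "has_bochner_integral lborel (\<lambda>x. indicator {0<..} x *\<^sub>R (x ^ k * exp (- x))) (fact k :: real)"
proof (rule has_bochner_integral_nn_integral)
  have "(\<integral>\<^sup>+x. ennreal (indicator {0<..} x *\<^sub>R (x ^ k * exp (- x))) \<partial>lborel) =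
      (\<integral>\<^sup>+x. ennreal (x ^ k * exp (- x)) * indicator {0..} x \<partial>lborel)"
    using AE_lborel_singleton[of "0::real"]
    by (intro nn_integral_cong_AE) (auto simp: indicator_def elim!: eventually_mono)
  then show "(\<integral>\<^sup>+x. ennreal (indicator {0<..} x *\<^sub>R (x ^ k * exp (- x))) \<partial>lborel) = ennreal (fact k)"
    by (simp add: nn_intergal_power_times_exp_Ici)
qed (auto simp: indicator_def)

lemma has_bochner_integral_product:
  fixes f g :: "real \<Rightarrow> real"
  assumes "has_bochner_integral lborel f a" "has_bochner_integral lborel g b"
  shows "has_bochner_integral (lborel \<Otimes>\<^sub>M lborel) (\<lambda>(x, y). f x * g y) (a * b)"
proof -
  have i: "integrable lborel f" "integrable lborel g" "a = integral\<^sup>L lborel f" "b = integral\<^sup>L lborel g"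
    using assms by (auto simp: has_bochner_integral_iff)
  then have [measurable]: "f \<in> borel_measurable borel" "g \<in> borel_measurable borel" by auto
  have int: "integrable (lborel \<Otimes>\<^sub>M lborel) (\<lambda>(x, y). f x * g y)"
    using i by (intro lborel_pair.Fubini_integrable) (auto simp: abs_mult)
  moreover have "integral\<^sup>L (lborel \<Otimes>\<^sub>M lborel) (\<lambda>(x, y). f x * g y) = a * b"
    using lborel_pair.integral_fst'[OF int] i by simp
  ultimately show ?thesis by (simp add: has_bochner_integral_iff)
qed

lemma Gamma_nu_shift:
  assumes "\<nu> \<ge> - 1/2"
  shows "Gamma (\<nu> + real j + 1) = pochhammer (\<nu> + 1) j * Gamma (\<nu> + 1)" "Gamma (\<nu> + 1) > 0"
proof -
  show G: "Gamma (\<nu> + 1) > 0" using assms by (intro Gamma_real_pos) auto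
  have "\<nu> + 1 \<notin> \<int>\<^sub>\<le>\<^sub>0" using assms nonpos_Ints_nonpos[of "\<nu> + 1"] by auto
  then show "Gamma (\<nu> + real j + 1) = pochhammer (\<nu> + 1) j * Gamma (\<nu> + 1)"
    using G pochhammer_Gamma[of "\<nu> + 1" j] by (simp add: add_ac)
qed

section \<open>Spans on the half-line\<close>

lemma span_on_pos_subset:
  assumes "\<And>j. j < n \<Longrightarrow> \<exists>c. \<forall>x>0. f j x = (\<Sum>i<n. c i * g i x)"
  shows "span_on_pos n f \<subseteq> span_on_pos n g"
proof -
  obtain C where C: "\<And>j x. j < n \<Longrightarrow> x > 0 \<Longrightarrow> f j x = (\<Sum>i<n. C j i * g i x)"
    using assms by metis
  have "(\<lambda>x\<in>{0<..}. \<Sum>j<n. c j * f j x) = (\<lambda>x\<in>{0<..}. \<Sum>i<n. (\<Sum>j<n. c j * C j i) * g i x)" for c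
  proof (rule restrict_ext)
    fix x :: real assume "x \<in> {0<..}"
    then have "(\<Sum>j<n. c j * f j x) = (\<Sum>j<n. \<Sum>i<n. c j * C j i * g i x)"
      by (simp add: C sum_distrib_left mult.assoc)
    also have "\<dots> = (\<Sum>i<n. (\<Sum>j<n. c j * C j i) * g i x)"
      by (subst sum.swap) (simp add: sum_distrib_right)
    finally show "(\<Sum>j<n. c j * f j x) = (\<Sum>i<n. (\<Sum>j<n. c j * C j i) * g i x)" .
  qed
  then show ?thesis unfolding span_on_pos_def by auto
qed

text \<open>Forward substitution in a triangular system with nonzero diagonal.\<close>

lemma span_on_pos_triangular:
  assumes f: "\<And>j x. j < n \<Longrightarrow> x > 0 \<Longrightarrow> f j x = (\<Sum>i\<le>j. A j i * x ^ i)"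
    and A: "\<And>j. j < n \<Longrightarrow> A j j \<noteq> 0"
  shows "span_on_pos n f = span_on_pos n (\<lambda>j x. x ^ j)"
proof
  show "span_on_pos n f \<subseteq> span_on_pos n (\<lambda>j x. x ^ j)"
  proof (rule span_on_pos_subset)
    fix j assume j: "j < n"
    have *: "f j x = (\<Sum>i<n. (if i \<le> j then A j i else 0) * x ^ i)" if "x > 0" for x
      unfolding f[OF j that] using j
      by (intro sum.mono_neutral_cong_left) auto
    show "\<exists>c. \<forall>x>0. f j x = (\<Sum>i<n. c i * x ^ i)"
      by (intro exI[of _ "\<lambda>i. if i \<le> j then A j i else 0"] allI impI *)
  qed
  show "span_on_pos n (\<lambda>j x. x ^ j) \<subseteq> span_on_pos n f"
  proof (rule span_on_pos_subset)
    fix j assume "j < n"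
    then show "\<exists>c. \<forall>x>0. x ^ j = (\<Sum>i<n. c i * f i x)"
    proof (induction j rule: less_induct)
      case (less j)
      define C where "C = (\<lambda>i. SOME c. \<forall>x>0. x ^ i = (\<Sum>k<n. c k * f k x))"
      have C: "x ^ i = (\<Sum>k<n. C i k * f k x)" if "i < j" "x > 0" for i x
      proof -
        have "\<exists>c. \<forall>x>0. x ^ i = (\<Sum>k<n. c k * f k x)"
          by (rule less.IH[OF that(1)]) (use that(1) less.prems in linarith)
        then have "\<forall>x>0. x ^ i = (\<Sum>k<n. C i k * f k x)"
          unfolding C_def by (rule someI_ex)
        then show ?thesis using that(2) by (elim allE impE)
      qed
      define c where "c = (\<lambda>k. ((if k = j then 1 else 0) - (\<Sum>i<j. A j i * C i k)) / A j j)"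
      have *: "x ^ j = (\<Sum>k<n. c k * f k x)" if x: "x > 0" for x
      proof -
        have "f j x = (\<Sum>i<j. A j i * x ^ i) + A j j * x ^ j"
          unfolding f[OF less.prems x] by (simp flip: lessThan_Suc_atMost)
        also have "(\<Sum>i<j. A j i * x ^ i) = (\<Sum>i<j. \<Sum>k<n. A j i * C i k * f k x)"
          by (intro sum.cong refl) (simp add: C x sum_distrib_left mult.assoc)
        also have "\<dots> = (\<Sum>k<n. (\<Sum>i<j. A j i * C i k) * f k x)"
          by (subst sum.swap) (simp add: sum_distrib_right)
        finally have "A j j * x ^ j = f j x - (\<Sum>k<n. (\<Sum>i<j. A j i * C i k) * f k x)" by simp
        also have "f j x = (\<Sum>k<n. (if k = j then 1 else 0) * f k x)"
        proof -
          have "(\<Sum>k<n. (if k = j then 1 else 0) * f k x) = (\<Sum>k<n. if k = j then f k x else 0)"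
            by (intro sum.cong) auto
          then show ?thesis using less.prems by simp
        qed
        also have "\<dots> - (\<Sum>k<n. (\<Sum>i<j. A j i * C i k) * f k x) = A j j * (\<Sum>k<n. c k * f k x)"
          unfolding sum_distrib_left sum_subtractf[symmetric] using A[OF less.prems]
          by (intro sum.cong refl) (simp add: c_def left_diff_distrib)
        finally show ?thesis using A[OF less.prems] by simp
      qed
      show ?case by (intro exI[of _ c] allI impI *)
    qed
  qed
qed

section \<open>Monic Laguerre polynomials\<close>

lemma coeff_laguerre:
  "coeff (laguerre m \<alpha>) k = (if k \<le> m then (- 1) ^ k * ((real m + \<alpha>) gchoose (m - k)) / fact k else 0)"
  unfolding laguerre_def by (simp add: coeff_sum)

lemma degree_laguerre: "degree (laguerre m \<alpha>) = m"
proof (rule antisym)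
  show "degree (laguerre m \<alpha>) \<le> m" by (intro degree_le) (simp add: coeff_laguerre)
  show "m \<le> degree (laguerre m \<alpha>)" by (intro le_degree) (simp add: coeff_laguerre)
qed

lemma gbinomial_times_fact:
  fixes a :: real
  shows "(a gchoose m) * fact m = pochhammer (a - real m + 1) m"
  by (simp add: gbinomial_pochhammer')

text \<open>The second identity says that the coefficients of the monic Laguerre polynomial are, up to the
  sign \<open>(-1)\<^sup>k\<close> and factors independent of \<open>k\<close>, the reciprocals of \<open>k! (\<nu> + 1)\<^sub>k\<close> and of \<open>(m - k)!\<close>. The former are the constants
  removed by the normalization of \<open>p\<^sub>k\<close>, the latter the integral of \<open>R\<^sup>m\<^sup>-\<^sup>k e\<^sup>-\<^sup>R\<close>.\<close>

lemma monic_laguerre: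
  assumes \<nu>: "\<nu> \<ge> - 1/2"
  shows "degree (monic_laguerre m \<nu>) = m"
    and "k \<le> m \<Longrightarrow> (- 1) ^ k * coeff (monic_laguerre m \<nu>) k * (fact k * pochhammer (\<nu> + 1) k) * fact (m - k) =
       (- 1) ^ m * fact m * pochhammer (\<nu> + 1) m"
proof -
  have lc: "lead_coeff (laguerre m \<nu>) = (- 1) ^ m / fact m"
    by (simp add: degree_laguerre coeff_laguerre)
  then show "degree (monic_laguerre m \<nu>) = m"
    by (simp add: monic_laguerre_def degree_laguerre)
  show "(- 1) ^ k * coeff (monic_laguerre m \<nu>) k * (fact k * pochhammer (\<nu> + 1) k) * fact (m - k) =
      (- 1) ^ m * fact m * pochhammer (\<nu> + 1) m" if k: "k \<le> m"
  proof -
    have c: "coeff (monic_laguerre m \<nu>) k = (- 1) ^ m * fact m * ((- 1) ^ k * ((real m + \<nu>) gchoose (m - k)) / fact k)"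
      unfolding monic_laguerre_def lc using k by (simp add: coeff_laguerre) (simp add: field_simps)
    have "(real m + \<nu> gchoose (m - k)) * fact (m - k) = pochhammer (\<nu> + 1 + real k) (m - k)"
      unfolding gbinomial_times_fact using k by (simp add: of_nat_diff algebra_simps)
    moreover have "pochhammer (\<nu> + 1) k * pochhammer (\<nu> + 1 + real k) (m - k) = pochhammer (\<nu> + 1) m"
      using k pochhammer_product[of k m "\<nu> + 1"] by simp
    ultimately have "pochhammer (\<nu> + 1) k * ((real m + \<nu> gchoose (m - k)) * fact (m - k)) = pochhammer (\<nu> + 1) m"
      by simp
    moreover have "(- 1) ^ k * ((- 1) ^ m * fact m * ((- 1) ^ k * ((real m + \<nu>) gchoose (m - k)) / fact k)) * (fact k * pochhammer (\<nu> + 1) k) * fact (m - k)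
        = (- 1) ^ m * fact m * (((- 1) ^ k * (- 1) ^ k) * (pochhammer (\<nu> + 1) k * ((real m + \<nu> gchoose (m - k)) * fact (m - k))))"
      by simp
    ultimately show ?thesis unfolding c by (simp flip: power_mult_distrib)
  qed
qed

section \<open>Moments and normalization of a Polya weight\<close>

locale polya_weight_function =
  fixes n :: nat and \<nu> :: real and \<omega> :: "real \<Rightarrow> real"
  assumes n: "n \<ge> 1" and \<nu>: "\<nu> \<ge> - 1/2" and \<omega>: "\<omega> \<in> L1_nu n \<nu>"
begin

abbreviation T :: "nat \<Rightarrow> real \<Rightarrow> real" where "T b \<equiv> (polya_op' \<nu> ^^ b) \<omega>"

definition moment :: "nat \<Rightarrow> real" where "moment k = (LINT x:{0<..}|lborel. x ^ k * \<omega> x)"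

lemma times_diff_\<omega>: "times_diff (2 * (n - 1)) \<omega>"
  using \<omega> by (simp add: L1_nu_def times_diff_def)

lemma polya_op_T: "b < n \<Longrightarrow> x > 0 \<Longrightarrow> (polya_op \<nu> ^^ b) \<omega> x = T b x"
  by (intro polya_op_funpow_eq times_diff_mono[OF times_diff_\<omega>]) auto

lemma integrable_T:
  assumes "a < n" "b < n"
  shows "set_integrable lborel {0<..} (\<lambda>x. x ^ a * T b x)"
proof -
  have "set_integrable lborel {0<..} (\<lambda>x. x powr (real (Suc a) - 1) * (polya_op \<nu> ^^ b) \<omega> x)"
    using \<omega> assms by (auto simp: L1_nu_def simp del: of_nat_Suc)
  also have "?this \<longleftrightarrow> ?thesis"
    using assms by (intro set_integrable_cong) (auto simp: polya_op_T powr_realpow)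
  finally show ?thesis .
qed

lemma moment_T:
  assumes "a < n" "b < n"
  shows "(LINT x:{0<..}|lborel. x ^ a * T b x) = moment_factor \<nu> a b * moment (a - b)"
  using assms
proof (induction b arbitrary: a)
  case 0
  then show ?case by (simp add: moment_def)
next
  case (Suc b)
  have "(LINT x:{0<..}|lborel. x ^ a * polya_op' \<nu> (T b) x) =
      real a * (real a + \<nu>) * (LINT x:{0<..}|lborel. x ^ (a - 1) * T b x)"
  proof (rule moment_polya_op'[where N = "n - 1"])
    show "times_diff 2 (T b)"
      using Suc.prems by (intro times_diff_polya_op'_funpow times_diff_mono[OF times_diff_\<omega>]) auto
    show "set_integrable lborel {0<..} (\<lambda>x. x ^ a * T b x)" if "a \<le> n - 1" for a
      using that Suc.prems n by (intro integrable_T) auto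
    show "set_integrable lborel {0<..} (\<lambda>x. x ^ a * polya_op' \<nu> (T b) x)" if "a \<le> n - 1" for a
      using that Suc.prems n integrable_T[of a "Suc b"] by auto
    show "((\<lambda>x. x powr (\<nu> + 1) * deriv (\<lambda>z. z powr (- \<nu>) * T b z) x) \<longlongrightarrow> 0) (at_right 0)"
      using \<omega> Suc.prems by (auto simp: L1_nu_def)
  qed (use Suc.prems in auto)
  also have "(LINT x:{0<..}|lborel. x ^ (a - 1) * T b x) = moment_factor \<nu> (a - 1) b * moment (a - 1 - b)"
    using Suc.prems by (intro Suc.IH) auto
  finally show ?case by (simp add: mult.assoc)
qed

lemma integrable_\<omega>: "set_integrable lborel {0<..} \<omega>"
  using \<omega> by (simp add: L1_nu_def)

text \<open>The \<open>k\<close>-th derivative of the Hankel transform on \<open>[0, \<infinity>)\<close>: each derivative brings down a factor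
  \<open>x\<close> and shifts the parameter of the Bessel kernel.\<close>

definition hankel_deriv :: "nat \<Rightarrow> real \<Rightarrow> real" where
  "hankel_deriv k t = (- 1) ^ k / pochhammer (\<nu> + 1) k *
     (LINT x|lborel. x ^ k * (indicator {0<..} x * \<omega> x) * bessel_entire (\<nu> + 1 + real k) (x * t))"

lemma hankel_deriv_0: "t \<ge> 0 \<Longrightarrow> hankel_deriv 0 t = hankel \<nu> \<omega> t"
  by (subst hankel_eq_bessel_transform[OF \<nu> integrable_\<omega>]) (auto simp: hankel_deriv_def)

text \<open>The Hankel transform is a generating function of the moments.\<close>

lemma hankel_deriv_at_0: "hankel_deriv k 0 = (- 1) ^ k / pochhammer (\<nu> + 1) k * moment k"
  by (simp add: hankel_deriv_def moment_def set_lebesgue_integral_def mult_ac)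

lemma integrable_power_\<omega>:
  "k < n \<Longrightarrow> integrable lborel (\<lambda>x. x ^ k * (indicator {0<..} x * \<omega> x))"
  using integrable_T[of k 0] n by (simp add: set_integrable_def mult_ac)

lemma hankel_deriv_DERIV:
  assumes "k < n - 1" "t \<ge> 0"
  shows "(hankel_deriv k has_real_derivative hankel_deriv (Suc k) t) (at t within {0..})"
proof -
  let ?g = "\<lambda>x. x ^ k * (indicator {0<..} x * \<omega> x)"
  have "((\<lambda>s. LINT x|lborel. ?g x * bessel_entire (\<nu> + 1 + real k) (x * s)) has_real_derivative
    (- 1 / (\<nu> + 1 + real k)) * (LINT x|lborel. x * ?g x * bessel_entire (\<nu> + 1 + real k + 1) (x * t))) (at t within {0..})"
    using assms \<nu> integrable_power_\<omega>[of k] integrable_power_\<omega>[of "Suc k"]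
    by (intro bessel_transform_DERIV) (auto simp: mult.assoc)
  from DERIV_cmult[OF this, of "(- 1) ^ k / pochhammer (\<nu> + 1) k"]
  show ?thesis unfolding hankel_deriv_def[abs_def] by (simp add: pochhammer_Suc mult_ac add_ac)
qed

lemma hankel_deriv_0_continuous: "(hankel_deriv 0 \<longlongrightarrow> hankel_deriv 0 t) (at t within {0..})"
  using bessel_transform_continuous[of "\<nu> + 1" "\<lambda>x. indicator {0<..} x * \<omega> x" t] \<nu> integrable_power_\<omega>[of 0] n
  by (simp add: hankel_deriv_def[abs_def])

text \<open>The matrix of integrals in \<open>andreief\<close> is lower triangular by \<open>moment_T\<close>. The restriction to positive
  arguments is encoded in the weights: an argument \<open>x\<^sub>i \<le> 0\<close> produces a zero column.\<close>

lemma integral_det_T: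
  "has_bochner_integral (\<Pi>\<^sub>M i\<in>{..<n}. lborel)
     (\<lambda>x. if \<forall>i<n. 0 < x i then vandermonde n x * Determinant.det (Matrix.mat n n (\<lambda>(b, c). T b (x c))) else 0)
     (fact n * (\<Prod>j<n. fact j * pochhammer (\<nu> + 1) j * moment 0))"
proof -
  let ?w = "\<lambda>b x. indicator {0<..} x * T b x"
  let ?M = "Matrix.mat n n (\<lambda>(a, b). LINT x|lborel. x ^ a * ?w b x)"
  have int: "integrable lborel (\<lambda>x. x ^ a * ?w b x)" if "a < n" "b < n" for a b
    using integrable_T[OF that] by (simp add: set_integrable_def mult_ac)
  have m: "(LINT x|lborel. x ^ a * ?w b x) = moment_factor \<nu> a b * moment (a - b)" if "a < n" "b < n" for a b
    using moment_T[OF that] by (simp add: set_lebesgue_integral_def mult_ac)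
  have "Determinant.det ?M = prod_list (diag_mat ?M)"
    by (rule det_lower_triangular[of n]) (auto simp: m moment_factor_eq[OF \<nu>])
  also have "\<dots> = (\<Prod>j<n. fact j * pochhammer (\<nu> + 1) j * moment 0)"
    by (simp add: prod_list_diag_prod lessThan_atLeast0 m moment_factor_eq[OF \<nu>])
  finally have det: "Determinant.det ?M = (\<Prod>j<n. fact j * pochhammer (\<nu> + 1) j * moment 0)" .
  have eq: "(if \<forall>i<n. 0 < x i then vandermonde n x * Determinant.det (Matrix.mat n n (\<lambda>(b, c). T b (x c))) else 0) =
     Determinant.det (Matrix.mat n n (\<lambda>(b, c). x c ^ b)) * Determinant.det (Matrix.mat n n (\<lambda>(b, c). ?w b (x c)))" for x
  proof (cases "\<forall>i<n. 0 < x i")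
    case True
    then have "Matrix.mat n n (\<lambda>(b, c). ?w b (x c)) = Matrix.mat n n (\<lambda>(b, c). T b (x c))"
      by (intro cong_mat) auto
    then show ?thesis using True by (simp add: vandermonde_eq_det)
  next
    case False
    then obtain i where i: "i < n" "x i \<le> 0" by (auto simp: not_less)
    have "Determinant.det (Matrix.mat n n (\<lambda>(b, c). ?w b (x c))) = 0"
    proof (subst mat_det_left_def[of _ n])
      show "(\<Sum>p | p permutes {0..<dim_row (Matrix.mat n n (\<lambda>(b, c). ?w b (x c)))}.
         signof p * (\<Prod>j = 0..<dim_row (Matrix.mat n n (\<lambda>(b, c). ?w b (x c))).
           Matrix.mat n n (\<lambda>(b, c). ?w b (x c)) $$ (p j, j))) = 0"
      proof (rule sum.neutral, rule ballI)
        fix p assume "p \<in> {p. p permutes {0..<dim_row (Matrix.mat n n (\<lambda>(b, c). ?w b (x c)))}}"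
        then have "p i < n" using permutes_in_image[of p "{0..<n}" i] i by auto
        then have "\<exists>j\<in>{0..<n}. Matrix.mat n n (\<lambda>(b, c). ?w b (x c)) $$ (p j, j) = 0"
          using i by (intro bexI[of _ i]) auto
        then show "signof p * (\<Prod>j = 0..<dim_row (Matrix.mat n n (\<lambda>(b, c). ?w b (x c))).
           Matrix.mat n n (\<lambda>(b, c). ?w b (x c)) $$ (p j, j)) = 0"
          by (simp add: prod_zero)
      qed
    qed simp
    then show ?thesis unfolding if_not_P[OF False] by (simp only: mult_zero_right)
  qed
  show ?thesis unfolding eq det[symmetric] by (rule andreief[where f = "\<lambda>a x. x ^ a", OF int])
qed

lemma polya_density_eq:
  "polya_density \<nu> n \<omega> x =
     1 / (fact n * (\<Prod>j<n. fact j * pochhammer (\<nu> + 1) j * moment 0)) *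
     (if \<forall>i<n. 0 < x i then vandermonde n x * Determinant.det (Matrix.mat n n (\<lambda>(b, c). T b (x c))) else 0)"
proof -
  have m0: "hankel \<nu> \<omega> 0 = moment 0" using hankel_deriv_0[of 0] hankel_deriv_at_0[of 0] by simp
  have "Gamma (\<nu> + 1) / (hankel \<nu> \<omega> 0 * fact j * Gamma (\<nu> + real j + 1)) =
      inverse (fact j * pochhammer (\<nu> + 1) j * moment 0)" for j
    unfolding m0 Gamma_nu_shift(1)[OF \<nu>] using Gamma_nu_shift(2)[OF \<nu>] by (simp add: field_simps)
  then have P: "(\<Prod>j<n. Gamma (\<nu> + 1) / (hankel \<nu> \<omega> 0 * fact j * Gamma (\<nu> + real j + 1))) =
      inverse (\<Prod>j<n. fact j * pochhammer (\<nu> + 1) j * moment 0)"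
    by (simp only: prod_inversef[symmetric] comp_def)
  have D: "Determinant.det (Matrix.mat n n (\<lambda>(a, b). T b (x a))) =
      Determinant.det (Matrix.mat n n (\<lambda>(b, c). T b (x c)))"
    by (subst det_transpose[symmetric, of _ n]) (auto intro!: arg_cong[of _ _ Determinant.det] eq_matI)
  have "(if A then 1 / f * inverse d * v * w else 0) = 1 / (f * d) * (if A then v * w else 0)"
    for A and f d v w :: real by (simp add: field_simps)
  then show ?thesis unfolding polya_density_def P D .
qed

text \<open>The constant \<open>C\<close> is determined by the total mass of the density. That \<open>\<omega>\<close> has nonzero
  integral also follows, since otherwise the total mass would vanish.\<close>

lemma unordered_sv_density_eq_polya_density:
  assumes d: "has_unordered_sv_density M n \<mu> (\<lambda>x. if \<forall>i<n. 0 < x i then C * (vandermonde n x *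
      Determinant.det (Matrix.mat n n (\<lambda>(b, c). polya_weight \<nu> \<omega> b (x c)))) else 0)"
    and nn: "\<And>x. (\<forall>i<n. 0 < x i) \<Longrightarrow> 0 \<le> vandermonde n x *
      Determinant.det (Matrix.mat n n (\<lambda>(b, c). polya_weight \<nu> \<omega> b (x c)))"
    and C: "C > 0" and \<mu>: "prob_space \<mu>"
  shows "moment 0 \<noteq> 0" "has_unordered_sv_density M n \<mu> (polya_density \<nu> n \<omega>)"
proof -
  define g where "g = (\<lambda>x. if \<forall>i<n. 0 < x i then vandermonde n x *
      Determinant.det (Matrix.mat n n (\<lambda>(b, c). T b (x c))) else 0)"
  let ?D = "fact n * (\<Prod>j<n. fact j * pochhammer (\<nu> + 1) j * moment 0)"
  have eq: "Matrix.mat n n (\<lambda>(b, c). polya_weight \<nu> \<omega> b (x c)) = Matrix.mat n n (\<lambda>(b, c). T b (x c))"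
    if "\<forall>i<n. 0 < x i" for x
    using that by (intro cong_mat) (auto simp: polya_weight_def polya_op_T)
  have g: "(\<lambda>x. if \<forall>i<n. 0 < x i then C * (vandermonde n x *
      Determinant.det (Matrix.mat n n (\<lambda>(b, c). polya_weight \<nu> \<omega> b (x c)))) else 0) = (\<lambda>x. C * g x)"
  proof
    show "(if \<forall>i<n. 0 < x i then C * (vandermonde n x *
      Determinant.det (Matrix.mat n n (\<lambda>(b, c). polya_weight \<nu> \<omega> b (x c)))) else 0) = C * g x" for x
    proof (cases "\<forall>i<n. 0 < x i")
      case True
      show ?thesis unfolding g_def eq[OF True] if_P[OF True] by (rule refl)
    next
      case False
      show ?thesis unfolding g_def if_not_P[OF False] by simp
    qed
  qed
  have g0: "g x \<ge> 0" for x
  proof (cases "\<forall>i<n. 0 < x i")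
    case True
    show ?thesis using nn[OF True] unfolding g_def eq[OF True] if_P[OF True] .
  next
    case False
    show ?thesis unfolding g_def if_not_P[OF False] by simp
  qed
  have "has_bochner_integral (\<Pi>\<^sub>M i\<in>{..<n}. lborel) g ?D"
    unfolding g_def by (rule integral_det_T)
  then have "has_bochner_integral (\<Pi>\<^sub>M i\<in>{..<n}. lborel) (\<lambda>x. C * g x) (C * ?D)"
    by (rule has_bochner_integral_mult_right)
  then have "(\<integral>\<^sup>+x. ennreal (C * g x) \<partial>(\<Pi>\<^sub>M i\<in>{..<n}. lborel)) = ennreal (C * ?D)"
    using C g0 by (subst nn_integral_eq_integral) (auto simp: has_bochner_integral_iff)
  with total_mass_unordered_sv_density[OF d[unfolded g] \<mu>] have CD: "C * ?D = 1"
    by (metis ennreal_eq_1)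
  then have C_eq: "C = 1 / ?D" by (metis nonzero_eq_divide_eq mult_zero_right zero_neq_one)
  show "moment 0 \<noteq> 0"
    using CD n by (auto simp: prod_zero_iff power_0_left)
  have "(\<lambda>x. C * g x) = polya_density \<nu> n \<omega>"
    unfolding C_eq polya_density_eq g_def by (rule refl)
  then show "has_unordered_sv_density M n \<mu> (polya_density \<nu> n \<omega>)"
    using d[unfolded g] by simp
qed

end
section \<open>Bi-orthonormal functions and their kernel\<close>

locale polya_weight_function_pos = polya_weight_function +
  assumes moment_0: "moment 0 \<noteq> 0"
begin

text \<open>The value of the \<open>(n - 1)\<close>-st power of the mixed operator on \<open>P / hankel \<nu> \<omega>\<close> at \<open>t = 0\<close>. Writing
  it as a function of the polynomial exposes the linearity in \<open>P\<close> that the kernel formula uses.\<close>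

definition mixed_poly :: "real \<Rightarrow> real poly \<Rightarrow> real \<Rightarrow> real" where
  "mixed_poly r P y = (\<Sum>i\<le>n - 1. real (n - 1 choose i) *
     (r ^ (n - 1 - i) * ((- 1) ^ i * recip_deriv hankel_deriv i 0 * poly ((adj_poly \<nu> ^^ i) P) y)))"

lemma mixed_poly_sum_smult:
  "mixed_poly r (\<Sum>k\<in>A. Polynomial.smult (c k) (P k)) y = (\<Sum>k\<in>A. c k * mixed_poly r (P k) y)"
  unfolding mixed_poly_def sum_distrib_left
  by (subst sum.swap)
    (simp add: adj_poly_funpow_sum adj_poly_funpow_linear poly_sum sum_distrib_left mult_ac)

lemma mixed_op_at_0:
  assumes F: "\<And>t v. t \<ge> 0 \<Longrightarrow> v > 0 \<Longrightarrow> F t v = poly P v / hankel \<nu> \<omega> t" and y: "y > 0"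
  shows "(mixed_op \<nu> r ^^ (n - 1)) F 0 y = mixed_poly r P y"
  unfolding mixed_poly_def
proof (rule mixed_op_funpow[where U = "{t. t \<ge> 0 \<and> hankel_deriv 0 t \<noteq> 0}" and N = "n - 1"])
  fix t assume t: "t \<in> {t. t \<ge> 0 \<and> hankel_deriv 0 t \<noteq> 0}"
  then have "\<forall>\<^sub>F s in at t within {0..}. hankel_deriv 0 s \<noteq> 0"
    by (intro tendsto_imp_eventually_ne[OF hankel_deriv_0_continuous]) auto
  then obtain d where "d > 0" "\<And>s. s \<ge> 0 \<Longrightarrow> s \<noteq> t \<Longrightarrow> dist s t < d \<Longrightarrow> hankel_deriv 0 s \<noteq> 0"
    unfolding eventually_at by auto
  then show "\<exists>d>0. \<forall>s\<ge>0. dist s t < d \<longrightarrow> s \<in> {t. t \<ge> 0 \<and> hankel_deriv 0 t \<noteq> 0}"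
    using t by auto
next
  fix i t assume "i < n - 1" "t \<in> {t. t \<ge> 0 \<and> hankel_deriv 0 t \<noteq> 0}"
  then show "(recip_deriv hankel_deriv i has_real_derivative recip_deriv hankel_deriv (Suc i) t) (at t within {0..})"
    by (intro recip_deriv_DERIV[where N = "n - 1"] hankel_deriv_DERIV) auto
qed (use y moment_0 in \<open>auto simp: F recip_deriv_0 hankel_deriv_0 hankel_deriv_at_0\<close>)

definition p_coeff :: "nat \<Rightarrow> nat \<Rightarrow> real" where
  "p_coeff j k = (- 1) ^ (j - k) * recip_deriv hankel_deriv (j - k) 0 / (fact (j - k) * (fact k * pochhammer (\<nu> + 1) k))"

lemma p_integrand_eq:
  assumes "y > 0"
  shows "p_integrand \<nu> n \<omega> j y r =
    exp (- r) * mixed_poly r (Polynomial.monom 1 j) y / (fact (n - 1) * (fact j * pochhammer (\<nu> + 1) j))"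
proof -
  have "(mixed_op \<nu> r ^^ (n - 1)) (\<lambda>t v. v ^ j / hankel \<nu> \<omega> t) 0 y = mixed_poly r (Polynomial.monom 1 j) y"
    by (rule mixed_op_at_0) (auto simp: poly_monom assms)
  then show ?thesis
    unfolding p_integrand_def Gamma_nu_shift(1)[OF \<nu>] using Gamma_nu_shift(2)[OF \<nu>] by simp
qed

text \<open>The integral of \<open>r\<^sup>n\<^sup>-\<^sup>1\<^sup>-\<^sup>i e\<^sup>-\<^sup>r\<close> is \<open>(n - 1 - i)!\<close>, which turns the binomial coefficient into
  \<open>(n - 1)! / i!\<close>. Thus \<open>n\<close> disappears and the Taylor coefficients of \<open>1 / hankel \<nu> \<omega>\<close> remain.\<close>

lemma has_integral_p_integrand:
  assumes j: "j < n" and y: "y > 0"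
  shows "has_bochner_integral lborel (\<lambda>r. indicator {0<..} r *\<^sub>R p_integrand \<nu> n \<omega> j y r)
     (\<Sum>k\<le>j. p_coeff j k * y ^ k)"
proof -
  let ?K = "fact (n - 1) * (fact j * pochhammer (\<nu> + 1) j) :: real"
  let ?c = "\<lambda>i. real (n - 1 choose i) * ((- 1) ^ i * recip_deriv hankel_deriv i 0 * (moment_factor \<nu> j i * y ^ (j - i))) / ?K"
  have "has_bochner_integral lborel
      (\<lambda>r. \<Sum>i\<le>n - 1. ?c i * (indicator {0<..} r *\<^sub>R (r ^ (n - 1 - i) * exp (- r))))
      (\<Sum>i\<le>n - 1. ?c i * fact (n - 1 - i))"
    by (intro has_bochner_integral_sum has_bochner_integral_mult_right has_bochner_integral_power_times_exp)
  moreover have "(\<lambda>r. \<Sum>i\<le>n - 1. ?c i * (indicator {0<..} r *\<^sub>R (r ^ (n - 1 - i) * exp (- r)))) =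
      (\<lambda>r. indicator {0<..} r *\<^sub>R p_integrand \<nu> n \<omega> j y r)"
    by (simp add: p_integrand_eq[OF y] mixed_poly_def adj_poly_funpow_monom poly_monom
        sum_distrib_left sum_divide_distrib mult_ac)
  moreover have "(\<Sum>i\<le>n - 1. ?c i * fact (n - 1 - i)) = (\<Sum>i\<le>j. p_coeff j (j - i) * y ^ (j - i))"
  proof (rule sum.mono_neutral_cong_right)
    show "\<forall>i\<in>{..n - 1} - {..j}. ?c i * fact (n - 1 - i) = 0"
      by (auto simp: moment_factor_eq[OF \<nu>])
    show "?c i * fact (n - 1 - i) = p_coeff j (j - i) * y ^ (j - i)" if "i \<in> {..j}" for i
    proof -
      have i: "i \<le> j" "i \<le> n - 1" using that j by auto
      have b: "fact (n - 1) = fact i * fact (n - 1 - i) * real (n - 1 choose i)"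
        using binomial_fact_lemma[OF i(2)] by (metis of_nat_fact of_nat_mult)
      have nz: "real (n - 1 choose i) \<noteq> 0" using i by simp
      have p: "pochhammer (\<nu> + 1) k \<noteq> 0" for k using pochhammer_nu_pos[OF \<nu>, of k] by simp
      show ?thesis
        unfolding b p_coeff_def moment_factor_eq[OF \<nu>]
        using i nz p[of j] p[of "j - i"] by (simp add: mult_ac)
    qed
  qed (use j in auto)
  moreover have "(\<Sum>i\<le>j. p_coeff j (j - i) * y ^ (j - i)) = (\<Sum>k\<le>j. p_coeff j k * y ^ k)"
    by (rule sum.reindex_bij_witness[of _ "\<lambda>k. j - k" "\<lambda>k. j - k"]) auto
  ultimately show ?thesis by simp
qed

lemma p_fun_eq:
  assumes "j < n" "y > 0"
  shows "set_integrable lborel {0<..} (p_integrand \<nu> n \<omega> j y)"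
    and "p_fun \<nu> n \<omega> j y = (\<Sum>k\<le>j. p_coeff j k * y ^ k)"
  using has_integral_p_integrand[OF assms]
  by (auto simp: has_bochner_integral_iff set_integrable_def p_fun_def set_lebesgue_integral_def)

text \<open>With \<open>d = l - m\<close>, the constants in the moments of \<open>T\<^sup>m \<omega>\<close> cancel those in the coefficients of
  \<open>p\<^sub>l\<close>, and the moment of order \<open>d - i\<close> becomes the derivative of order \<open>d - i\<close> of the Hankel
  transform. What is left is \<open>(-1)\<^sup>d / d!\<close> times the \<open>d\<close>-th derivative of \<open>h \<cdot> (1/h) = 1\<close>.\<close>

lemma p_q_integral:
  assumes l: "l < n" and m: "m < n"
  shows "set_integrable lborel {0<..} (\<lambda>x. p_fun \<nu> n \<omega> l x * q_fun \<nu> \<omega> m x)"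
    and "(LINT x:{0<..}|lborel. p_fun \<nu> n \<omega> l x * q_fun \<nu> \<omega> m x) = (if l = m then 1 else 0)"
proof -
  let ?S = "\<Sum>k\<le>l. p_coeff l k * (moment_factor \<nu> k m * moment (k - m))"
  have "has_bochner_integral lborel (\<lambda>x. \<Sum>k\<le>l. p_coeff l k * (indicator {0<..} x *\<^sub>R (x ^ k * T m x))) ?S"
  proof (intro has_bochner_integral_sum has_bochner_integral_mult_right)
    fix k assume "k \<in> {..l}"
    then show "has_bochner_integral lborel (\<lambda>x. indicator {0<..} x *\<^sub>R (x ^ k * T m x)) (moment_factor \<nu> k m * moment (k - m))"
      using integrable_T[of k m] moment_T[of k m] l m
      by (simp add: has_bochner_integral_iff set_integrable_def set_lebesgue_integral_def)
  qed
  moreover have "(\<lambda>x. \<Sum>k\<le>l. p_coeff l k * (indicator {0<..} x *\<^sub>R (x ^ k * T m x))) =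
      (\<lambda>x. indicator {0<..} x *\<^sub>R (p_fun \<nu> n \<omega> l x * q_fun \<nu> \<omega> m x))"
  proof
    fix x :: real
    show "(\<Sum>k\<le>l. p_coeff l k * (indicator {0<..} x *\<^sub>R (x ^ k * T m x))) =
      indicator {0<..} x *\<^sub>R (p_fun \<nu> n \<omega> l x * q_fun \<nu> \<omega> m x)"
    proof (cases "x > 0")
      case True
      then show ?thesis
        unfolding p_fun_eq(2)[OF l True] q_fun_def sum_distrib_right by (simp add: mult.assoc)
    qed simp
  qed
  ultimately have bi: "has_bochner_integral lborel
      (\<lambda>x. indicator {0<..} x *\<^sub>R (p_fun \<nu> n \<omega> l x * q_fun \<nu> \<omega> m x)) ?S" by simp
  then show "set_integrable lborel {0<..} (\<lambda>x. p_fun \<nu> n \<omega> l x * q_fun \<nu> \<omega> m x)"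
    by (simp add: has_bochner_integral_iff set_integrable_def)
  have "(LINT x:{0<..}|lborel. p_fun \<nu> n \<omega> l x * q_fun \<nu> \<omega> m x) = ?S"
    using bi by (simp add: has_bochner_integral_iff set_lebesgue_integral_def)
  also have "\<dots> = (if l = m then 1 else 0)"
  proof (cases "m \<le> l")
    case False
    then show ?thesis by (auto simp: moment_factor_eq[OF \<nu>])
  next
    case True
    define d where "d = l - m"
    have p: "pochhammer (\<nu> + 1) k \<noteq> 0" for k using pochhammer_nu_pos[OF \<nu>, of k] by simp
    have "?S = (\<Sum>k\<in>{m..l}. p_coeff l k * (moment_factor \<nu> k m * moment (k - m)))"
      by (rule sum.mono_neutral_right) (auto simp: moment_factor_eq[OF \<nu>])
    also have "\<dots> = (\<Sum>i\<le>d. (- 1) ^ d / fact d * (real (d choose i) * recip_deriv hankel_deriv i 0 * hankel_deriv (d - i) 0))"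
    proof (rule sum.reindex_bij_witness[of _ "\<lambda>i. l - i" "\<lambda>k. l - k"])
      show "(- 1) ^ d / fact d * (real (d choose (l - k)) * recip_deriv hankel_deriv (l - k) 0 * hankel_deriv (d - (l - k)) 0) =
          p_coeff l k * (moment_factor \<nu> k m * moment (k - m))" if "k \<in> {m..l}" for k
      proof -
        define i where "i = l - k"
        have k: "k = l - i" "i \<le> d" "k - m = d - i" "m \<le> k" using that True by (auto simp: i_def d_def)
        have b: "fact d = fact i * fact (d - i) * real (d choose i)"
          using binomial_fact_lemma[OF k(2)] by (metis of_nat_fact of_nat_mult)
        have nz: "real (d choose i) \<noteq> 0" using k by simp
        have s: "(- 1) ^ d = (- 1) ^ i * (- 1 :: real) ^ (d - i)"
          using k(2) by (simp flip: power_add)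
        have ss: "(- 1) ^ (d - i) * ((- 1 :: real) ^ (d - i) * z) = z" for z
          by (simp flip: mult.assoc power_mult_distrib)
        show ?thesis
          unfolding p_coeff_def moment_factor_eq[OF \<nu>] hankel_deriv_at_0 i_def[symmetric] k(3) if_P[OF k(4)]
          unfolding b s using nz p by (simp add: ss mult_ac)
      qed
    qed (use True in \<open>auto simp: d_def\<close>)
    also have "\<dots> = (- 1) ^ d / fact d * (\<Sum>i\<le>d. real (d choose i) * recip_deriv hankel_deriv i 0 * hankel_deriv (d - i) 0)"
      by (simp add: sum_distrib_left)
    also have "(\<Sum>i\<le>d. real (d choose i) * recip_deriv hankel_deriv i 0 * hankel_deriv (d - i) 0) = (if d = 0 then 1 else 0)"
      using moment_0 by (intro recip_deriv_leibniz) (simp add: hankel_deriv_at_0)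
    finally show ?thesis using True by (auto simp: d_def)
  qed
  finally show "(LINT x:{0<..}|lborel. p_fun \<nu> n \<omega> l x * q_fun \<nu> \<omega> m x) = (if l = m then 1 else 0)" .
qed

lemma described_by_p_q: "described_by n (polya_weight \<nu> \<omega>) (p_fun \<nu> n \<omega>) (q_fun \<nu> \<omega>)"
  unfolding described_by_def
proof (intro conjI allI impI)
  show "span_on_pos n (p_fun \<nu> n \<omega>) = span_on_pos n (\<lambda>j x. x ^ j)"
  proof (rule span_on_pos_triangular[OF p_fun_eq(2)])
    show "p_coeff j j \<noteq> 0" for j
      using pochhammer_nu_pos[OF \<nu>, of j] moment_0 by (simp add: p_coeff_def recip_deriv_0 hankel_deriv_at_0)
  qed
  show "span_on_pos n (q_fun \<nu> \<omega>) = span_on_pos n (polya_weight \<nu> \<omega>)"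
    unfolding span_on_pos_def
    by (intro arg_cong[where f = range] ext restrict_ext sum.cong refl)
      (simp add: q_fun_def polya_weight_def polya_op_T)
qed (use p_q_integral in auto)

text \<open>The variable \<open>R\<close> enters the polynomial only through the powers \<open>R\<^sup>-\<^sup>k\<close>, so each term separates into
  a function of \<open>r\<close>, which is the integrand of \<open>p\<^sub>k\<close>, and a function of \<open>R\<close>.\<close>

lemma kernel_integrand_eq:
  assumes y': "y' > 0" and R: "R > 0"
  shows "kernel_integrand \<nu> n \<omega> y' y r R =
    (\<Sum>k\<le>n - 1. (- 1) ^ k * coeff (monic_laguerre (n - 1) \<nu>) k * T k y *
       (fact (n - 1) * (fact k * pochhammer (\<nu> + 1) k)) *
       (p_integrand \<nu> n \<omega> k y' r * (R ^ (n - 1 - k) * exp (- R))))"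
proof -
  define c where "c = (\<lambda>k. coeff (monic_laguerre (n - 1) \<nu>) k * ((- 1) ^ k / R ^ k) * T k y)"
  let ?P = "\<Sum>k\<le>n - 1. Polynomial.smult (c k) (Polynomial.monom 1 k)"
  have "1 / hankel \<nu> \<omega> t * poly_of_op (monic_laguerre (n - 1) \<nu>) (- (v / R)) (polya_op' \<nu>) \<omega> y =
      poly ?P v / hankel \<nu> \<omega> t" for t v
    by (simp add: poly_of_op_def monic_laguerre(1)[OF \<nu>] poly_sum poly_monom c_def power_divide
        sum_divide_distrib power_minus[of "v / R"] mult_ac)
  then have "(mixed_op \<nu> r ^^ (n - 1)) (\<lambda>t v. 1 / hankel \<nu> \<omega> t *
      poly_of_op (monic_laguerre (n - 1) \<nu>) (- (v / R)) (polya_op' \<nu>) \<omega> y) 0 y' = mixed_poly r ?P y'"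
    by (intro mixed_op_at_0 y')
  also have "\<dots> = (\<Sum>k\<le>n - 1. c k * mixed_poly r (Polynomial.monom 1 k) y')"
    by (rule mixed_poly_sum_smult)
  finally have *: "kernel_integrand \<nu> n \<omega> y' y r R =
      (\<Sum>k\<le>n - 1. R ^ (n - 1) * exp (- r - R) * (c k * mixed_poly r (Polynomial.monom 1 k) y'))"
    by (simp add: kernel_integrand_def sum_distrib_left)
  show ?thesis unfolding *
  proof (rule sum.cong[OF refl])
    fix k assume "k \<in> {..n - 1}"
    then have "n - 1 = k + (n - 1 - k)" by simp
    then have k: "R ^ (n - 1) = R ^ k * R ^ (n - 1 - k)" by (metis power_add)
    have "R ^ (n - 1) * exp (- r - R) * (c k * mixed_poly r (Polynomial.monom 1 k) y') =
        (- 1) ^ k * coeff (monic_laguerre (n - 1) \<nu>) k * T k y *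
        ((exp (- r) * mixed_poly r (Polynomial.monom 1 k) y') * (R ^ (n - 1 - k) * exp (- R)))"
      unfolding k c_def using R by (simp add: power_divide exp_diff exp_minus divide_simps)
    also have "exp (- r) * mixed_poly r (Polynomial.monom 1 k) y' =
        fact (n - 1) * (fact k * pochhammer (\<nu> + 1) k) * p_integrand \<nu> n \<omega> k y' r"
      using pochhammer_nu_pos[OF \<nu>, of k] by (simp add: p_integrand_eq[OF y'])
    finally show "R ^ (n - 1) * exp (- r - R) * (c k * mixed_poly r (Polynomial.monom 1 k) y') =
       (- 1) ^ k * coeff (monic_laguerre (n - 1) \<nu>) k * T k y *
       (fact (n - 1) * (fact k * pochhammer (\<nu> + 1) k)) *
       (p_integrand \<nu> n \<omega> k y' r * (R ^ (n - 1 - k) * exp (- R)))"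
      by (simp add: mult_ac)
  qed
qed

lemma has_integral_kernel_integrand:
  assumes y': "y' > 0"
  shows "has_bochner_integral (lborel \<Otimes>\<^sub>M lborel)
    (\<lambda>z. indicator ({0<..} \<times> {0<..}) z *\<^sub>R (case z of (r, R) \<Rightarrow> kernel_integrand \<nu> n \<omega> y' y r R))
    ((- 1) ^ (n - 1) * (fact (n - 1))\<^sup>2 * pochhammer (\<nu> + 1) (n - 1) *
      biorth_kernel n (p_fun \<nu> n \<omega>) (q_fun \<nu> \<omega>) y' y)"
proof -
  let ?L = "coeff (monic_laguerre (n - 1) \<nu>)"
  let ?c = "\<lambda>k. (- 1) ^ k * ?L k * T k y * (fact (n - 1) * (fact k * pochhammer (\<nu> + 1) k))"
  let ?f = "\<lambda>k (r, R). (indicator {0<..} r *\<^sub>R p_integrand \<nu> n \<omega> k y' r) *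
      (indicator {0<..} R *\<^sub>R (R ^ (n - 1 - k) * exp (- R)))"
  have "has_bochner_integral (lborel \<Otimes>\<^sub>M lborel) (\<lambda>z. \<Sum>k\<le>n - 1. ?c k * ?f k z)
      (\<Sum>k\<le>n - 1. ?c k * (p_fun \<nu> n \<omega> k y' * fact (n - 1 - k)))"
  proof (intro has_bochner_integral_sum has_bochner_integral_mult_right has_bochner_integral_product
      has_bochner_integral_power_times_exp)
    fix k assume "k \<in> {..n - 1}"
    then have k: "k < n" using n by auto
    show "has_bochner_integral lborel (\<lambda>r. indicator {0<..} r *\<^sub>R p_integrand \<nu> n \<omega> k y' r) (p_fun \<nu> n \<omega> k y')"
      using has_integral_p_integrand[OF k y'] p_fun_eq(2)[OF k y'] by simp
  qed
  moreover have "(\<lambda>z. \<Sum>k\<le>n - 1. ?c k * ?f k z) =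
      (\<lambda>z. indicator ({0<..} \<times> {0<..}) z *\<^sub>R (case z of (r, R) \<Rightarrow> kernel_integrand \<nu> n \<omega> y' y r R))"
  proof
    fix z :: "real \<times> real"
    obtain r R where z: "z = (r, R)" by (cases z)
    show "(\<Sum>k\<le>n - 1. ?c k * ?f k z) =
        indicator ({0<..} \<times> {0<..}) z *\<^sub>R (case z of (r, R) \<Rightarrow> kernel_integrand \<nu> n \<omega> y' y r R)"
      by (cases "r > 0"; cases "R > 0") (simp_all add: z kernel_integrand_eq[OF y'])
  qed
  moreover have "(\<Sum>k\<le>n - 1. ?c k * (p_fun \<nu> n \<omega> k y' * fact (n - 1 - k))) =
      (- 1) ^ (n - 1) * (fact (n - 1))\<^sup>2 * pochhammer (\<nu> + 1) (n - 1) *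
      biorth_kernel n (p_fun \<nu> n \<omega>) (q_fun \<nu> \<omega>) y' y"
  proof -
    have "{..n - 1} = {..<n}" using n by auto
    moreover have "?c k * (p_fun \<nu> n \<omega> k y' * fact (n - 1 - k)) =
        (- 1) ^ (n - 1) * (fact (n - 1))\<^sup>2 * pochhammer (\<nu> + 1) (n - 1) * (p_fun \<nu> n \<omega> k y' * q_fun \<nu> \<omega> k y)"
      if "k \<in> {..<n}" for k
    proof -
      have "?c k * (p_fun \<nu> n \<omega> k y' * fact (n - 1 - k)) =
          ((- 1) ^ k * ?L k * (fact k * pochhammer (\<nu> + 1) k) * fact (n - 1 - k)) *
          (fact (n - 1) * (p_fun \<nu> n \<omega> k y' * q_fun \<nu> \<omega> k y))"
        by (simp add: q_fun_def mult_ac)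
      also have "(- 1) ^ k * ?L k * (fact k * pochhammer (\<nu> + 1) k) * fact (n - 1 - k) =
          (- 1) ^ (n - 1) * fact (n - 1) * pochhammer (\<nu> + 1) (n - 1)"
        using that by (intro monic_laguerre(2) \<nu>) auto
      finally show ?thesis by (simp add: power2_eq_square mult_ac)
    qed
    ultimately show ?thesis
      unfolding biorth_kernel_def sum_distrib_left by (intro sum.cong) auto
  qed
  ultimately show ?thesis by simp
qed

end

theorem mainTheorem4:
  fixes M :: mat_space and n :: nat and \<nu> :: real
    and \<omega> :: "real \<Rightarrow> real" and \<mu> :: "complex mat measure"
  assumes "n \<ge> 1" and "\<nu> = nu_of M" and "polya_ensemble M n \<omega> \<mu>"
  shows "has_unordered_sv_density M n \<mu> (polya_density \<nu> n \<omega>)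
    \<and> (\<forall>j<n. \<forall>y'>0. set_integrable lborel {0<..} (p_integrand \<nu> n \<omega> j y'))
    \<and> described_by n (polya_weight \<nu> \<omega>) (p_fun \<nu> n \<omega>) (q_fun \<nu> \<omega>)
    \<and> (\<forall>y'>0. \<forall>y>0.
         set_integrable (lborel \<Otimes>\<^sub>M lborel) ({0<..} \<times> {0<..})
           (\<lambda>(r, R). kernel_integrand \<nu> n \<omega> y' y r R)
         \<and> biorth_kernel n (p_fun \<nu> n \<omega>) (q_fun \<nu> \<omega>) y' y =
           (- 1) ^ (n - 1) * Gamma (\<nu> + 1) / ((fact (n - 1))\<^sup>2 * Gamma (\<nu> + real n)) *
           (LINT z:{0<..} \<times> {0<..}|(lborel \<Otimes>\<^sub>M lborel).
              (case z of (r, R) \<Rightarrow> kernel_integrand \<nu> n \<omega> y' y r R)))"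
proof -
  let ?g = "\<lambda>x. vandermonde n x *
    Determinant.det (Matrix.mat n n (\<lambda>(b, c). polya_weight \<nu> \<omega> b (x c)))"
  have \<nu>: "\<nu> \<ge> - 1/2" unfolding assms(2) by (cases M) auto
  note pe = assms(3)[unfolded polya_ensemble_def Let_def assms(2)[symmetric]]
  have \<omega>: "\<omega> \<in> L1_nu n \<nu>" and prob: "prob_space \<mu>"
    using pe by (rule conjunct1, elim conjE)
  have nn: "0 \<le> ?g x" if "\<forall>i<n. 0 < x i" for x
    by (rule mp[OF spec[OF pe[THEN conjunct2, THEN conjunct2, THEN conjunct2, THEN conjunct1]] that])
  from pe obtain C where C: "C > 0"
    and d: "has_unordered_sv_density M n \<mu> (\<lambda>x. if \<forall>i<n. 0 < x i then C * ?g x else 0)"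
    by (elim conjE exE)
  interpret polya_weight_function n \<nu> \<omega>
    by unfold_locales (use assms(1) \<nu> \<omega> in auto)
  have density: "moment 0 \<noteq> 0" "has_unordered_sv_density M n \<mu> (polya_density \<nu> n \<omega>)"
    by (rule unordered_sv_density_eq_polya_density[OF d nn C prob]; assumption)+
  interpret polya_weight_function_pos n \<nu> \<omega>
    by unfold_locales (rule density(1))
  have n_eq: "\<nu> + real n = \<nu> + real (n - 1) + 1" using assms(1) by (simp add: of_nat_diff)
  have G: "Gamma (\<nu> + real n) = pochhammer (\<nu> + 1) (n - 1) * Gamma (\<nu> + 1)"
    unfolding n_eq by (rule Gamma_nu_shift(1)[OF \<nu>])
  have nz: "pochhammer (\<nu> + 1) (n - 1) \<noteq> 0" "Gamma (\<nu> + 1) \<noteq> 0"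
    using pochhammer_nu_pos[OF \<nu>, of "n - 1"] Gamma_nu_shift(2)[OF \<nu>] by auto
  have kernel: "set_integrable (lborel \<Otimes>\<^sub>M lborel) ({0<..} \<times> {0<..})
           (\<lambda>(r, R). kernel_integrand \<nu> n \<omega> y' y r R)
         \<and> biorth_kernel n (p_fun \<nu> n \<omega>) (q_fun \<nu> \<omega>) y' y =
           (- 1) ^ (n - 1) * Gamma (\<nu> + 1) / ((fact (n - 1))\<^sup>2 * Gamma (\<nu> + real n)) *
           (LINT z:{0<..} \<times> {0<..}|(lborel \<Otimes>\<^sub>M lborel).
              (case z of (r, R) \<Rightarrow> kernel_integrand \<nu> n \<omega> y' y r R))" if "y' > 0" for y' y
  proof
    let ?I = "LINT z:{0<..} \<times> {0<..}|(lborel \<Otimes>\<^sub>M lborel). (case z of (r, R) \<Rightarrow> kernel_integrand \<nu> n \<omega> y' y r R)"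
    let ?B = "biorth_kernel n (p_fun \<nu> n \<omega>) (q_fun \<nu> \<omega>) y' y"
    note K = has_integral_kernel_integrand[OF that, of y, unfolded has_bochner_integral_iff]
    show "set_integrable (lborel \<Otimes>\<^sub>M lborel) ({0<..} \<times> {0<..}) (\<lambda>(r, R). kernel_integrand \<nu> n \<omega> y' y r R)"
      using K unfolding set_integrable_def by blast
    have I: "?I = (- 1) ^ (n - 1) * (fact (n - 1))\<^sup>2 * pochhammer (\<nu> + 1) (n - 1) * ?B"
      using K unfolding set_lebesgue_integral_def by blast
    have "(- 1) ^ (n - 1) * Gamma (\<nu> + 1) / ((fact (n - 1))\<^sup>2 * Gamma (\<nu> + real n)) * ?I =
        ((- 1) ^ (n - 1) * (- 1) ^ (n - 1)) * ?B"
      unfolding I G using nz by (simp add: divide_simps)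
    then show "?B = (- 1) ^ (n - 1) * Gamma (\<nu> + 1) / ((fact (n - 1))\<^sup>2 * Gamma (\<nu> + real n)) * ?I"
      by (simp flip: power_mult_distrib)
  qed
  show ?thesis
    by (intro conjI[OF density(2)] conjI[OF _ conjI[OF described_by_p_q]] allI impI kernel p_fun_eq(1))
qed

end
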